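(* Let $k\ge 3$ and let $G$ be a fair complete $k$-partite graph whose edges are coloured red and blue. Then the vertex set of $G$ can be partitioned into a red path and a blue path.
   Context: A complete $k$-partite graph has $k$ partition classes, all of which are assumed non-empty. A complete multipartite graph on $n$ vertices is called fair if no partition class contains more than $n/2$ vertices. A colouring of the edges is an arbitrary assignment of the colours red and blue to the edges (not necessarily proper). A monochromatic path of a given colour uses only edges of that colour; a path may be trivial (a single vertex) or empty, and a trivial or empty path counts as a path of either colour. "Partitioned into" means the two paths are vertex-disjoint and together cover all vertices. *)

theory Defs
  imports Main "HOL-Library.Disjoint_Sets"
begin

text \<open>A complete multipartite graph on the finite vertex set V is given by a partition P
  of V into non-empty classes; two vertices are adjacent iff they lie in different classes.\<close>

definition cmp_adj :: "'a set set \<Rightarrow> 'a \<Rightarrow> 'a \<Rightarrow> bool" where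
  "cmp_adj P u v \<longleftrightarrow> (\<exists>X\<in>P. u \<in> X) \<and> (\<exists>Y\<in>P. v \<in> Y) \<and> \<not> (\<exists>X\<in>P. u \<in> X \<and> v \<in> X)"

definition fair :: "'a set \<Rightarrow> 'a set set \<Rightarrow> bool" where
  "fair V P \<longleftrightarrow> (\<forall>X\<in>P. 2 * card X \<le> card V)"

text \<open>A (possibly empty or trivial) path in the graph with adjacency relation adj all of
  whose edges have colour col, where the colouring is col_of :: 'a => 'a => bool
  (True = red, False = blue). The path is given as a list of distinct vertices.\<close>
definition mono_path :: "('a \<Rightarrow> 'a \<Rightarrow> bool) \<Rightarrow> ('a \<Rightarrow> 'a \<Rightarrow> bool) \<Rightarrow> bool \<Rightarrow> 'a list \<Rightarrow> bool" where
  "mono_path adj col_of col p \<longleftrightarrow> distinct p \<and>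
     (\<forall>i. Suc i < length p \<longrightarrow> adj (p ! i) (p ! Suc i) \<and> col_of (p ! i) (p ! Suc i) = col)"

end

theory Submission
  imports Defs
begin

text \<open>
  The two smallest of at least four classes together contain at most half of the vertices, so merging
  them keeps the graph fair and reduces the theorem to three classes. There we prove more: V has a
  Hamiltonian path that changes colour at most once. Such a path is recorded as a \<^emph>\<open>spider\<close>, a centre
  with one monochromatic arm in each colour. Two disjoint paths of different colours with adjacent
  endpoints always yield a spider, whichever colour the joining edge has.

  Let A be a largest class and n = |V|. If n - 2|A| is at least 2, remove one vertex from each class.
  Were V without a spider, then spiders on V minus one, two or three of these vertices could only end
  in the classes of the missing vertices; for three missing vertices a case analysis of the centre
  contradicts this. If n - 2|A| = 1, a vertex outside A is removed and reabsorbed. If n = 2|A|, keep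
  only the edges between A and its complement. A maximal balanced set carrying a spider in this
  bipartite graph is either everything, or it forces a \<^emph>\<open>split\<close> colouring: both sides are halved so
  that an edge is red iff its ends lie in corresponding halves. In the split case an edge between the
  two halves of the complement of A, which exists since there are three classes, connects the pieces.
\<close>

section \<open>Lists in which marked entries are never consecutive\<close>

lemma not_successively_split:
  "\<not> successively Q xs \<Longrightarrow> \<exists>as x y bs. xs = as @ x # y # bs \<and> \<not> Q x y"
proof (induction xs rule: induct_list012)
  case (3 x y zs)
  then show ?case
    by (metis append_Cons append_Nil successively.simps(3))
qed auto

text \<open>Between two entries in \<open>P\<close> there is always one outside \<open>P\<close>,
  which leaves a surplus of at most one; each end of the list that lies outside \<open>P\<close>
  uses up one more.\<close>

lemma sparse_count:
  assumes "successively (\<lambda>x y. \<not> (P x \<and> P y)) xs" "xs \<noteq> []"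
  shows "length (filter P xs) + of_bool (\<not> P (hd xs)) + of_bool (\<not> P (last xs))
    \<le> length (filter (\<lambda>x. \<not> P x) xs) + 1"
  using assms by (induction xs rule: induct_list012) (auto split: if_splits)

section \<open>Coloured paths, spiders and joining two paths\<close>

text \<open>\<open>c\<close> names the class of a vertex. Its label type stays arbitrary so that the
  same lemmas serve the three classes and the bipartition into one class and its complement.\<close>

locale two_colouring =
  fixes c :: "'a \<Rightarrow> 'b" and E :: "'a \<Rightarrow> 'a \<Rightarrow> bool"
  assumes E_sym: "E x y = E y x"
begin

definition link :: "bool \<Rightarrow> 'a \<Rightarrow> 'a \<Rightarrow> bool" where
  "link k x y \<longleftrightarrow> c x \<noteq> c y \<and> E x y = k"

abbreviation path :: "bool \<Rightarrow> 'a list \<Rightarrow> bool" where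
  "path k \<equiv> successively (link k)"

lemma link_sym: "link k x y = link k y x"
  unfolding link_def using E_sym by metis

lemma link_cases: "c x \<noteq> c y \<Longrightarrow> link k x y \<or> link (\<not> k) x y"
  by (auto simp: link_def)

lemma link_adj: "link k x y \<Longrightarrow> c x \<noteq> c y"
  by (auto simp: link_def)

lemma path_flip [simp]: "successively (\<lambda>x y. link k y x) xs = path k xs"
  by (rule arg_cong[where f = "\<lambda>r. successively r xs"]) (use link_sym in blast)

lemma path_rev: "path k (rev xs) = path k xs"
  by simp

definition cover :: "bool \<Rightarrow> 'a set \<Rightarrow> 'a list \<Rightarrow> 'a list \<Rightarrow> bool" where
  "cover k V R B \<longleftrightarrow> path k R \<and> path (\<not> k) B \<and> distinct (R @ B) \<and> set R \<union> set B = V"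

definition spider :: "bool \<Rightarrow> 'a set \<Rightarrow> 'a \<Rightarrow> 'a list \<Rightarrow> 'a list \<Rightarrow> bool" where
  "spider k V w R B \<longleftrightarrow> path k (w # R) \<and> path (\<not> k) (w # B) \<and> distinct (w # R @ B)
     \<and> insert w (set R \<union> set B) = V"

text \<open>\<open>x\<close> ends the arm of colour \<open>k\<close> and \<open>y\<close> the other
  one. The ends are read off \<open>w # R\<close> and \<open>w # B\<close>, so an empty arm ends at
  the centre.\<close>

definition ham :: "bool \<Rightarrow> 'a set \<Rightarrow> 'a \<Rightarrow> 'a \<Rightarrow> bool" where
  "ham k V x y \<longleftrightarrow> (\<exists>w R B. spider k V w R B \<and> last (w # R) = x \<and> last (w # B) = y)"

definition hamiltonian :: "'a set \<Rightarrow> bool" where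
  "hamiltonian V \<longleftrightarrow> (\<exists>k x y. ham k V x y)"

lemma spider_swap: "spider k V w R B \<Longrightarrow> spider (\<not> k) V w B R"
  by (auto simp: spider_def)

lemma spider_ham: "spider k V w R B \<Longrightarrow> ham k V (last (w # R)) (last (w # B))"
  unfolding ham_def by blast

lemma cover_swap: "cover k V R B \<Longrightarrow> cover (\<not> k) V B R"
  by (auto simp: cover_def)

lemma cover_rev_left: "cover k V R B \<Longrightarrow> cover k V (rev R) B"
  by (auto simp: cover_def)

lemma cover_rev_right: "cover k V R B \<Longrightarrow> cover k V R (rev B)"
  by (auto simp: cover_def)

text \<open>The edge between the two heads prolongs the path of its own colour, and the head gained
  by that path becomes the centre. The far ends do not change.\<close>

lemma join_centre:
  assumes "cover k V R B" "R \<noteq> []" "B \<noteq> []" "c (hd R) \<noteq> c (hd B)"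
  shows "\<exists>w R' B'. spider k V w R' B' \<and> (w = hd R \<or> w = hd B)
    \<and> last (w # R') = last R \<and> last (w # B') = last B"
proof -
  obtain x R' where R: "R = x # R'" using assms(2) by (cases R) auto
  obtain y B' where B: "B = y # B'" using assms(3) by (cases B) auto
  consider "link (\<not> k) x y" | "link k y x"
    using link_cases[of x y k] link_sym assms(4) R B by auto
  then show ?thesis
  proof cases
    case 1
    then have "spider k V x R' B"
      using assms(1) R B by (auto simp: cover_def spider_def)
    then show ?thesis using R B by (intro exI[of _ x] exI[of _ R'] exI[of _ B]) auto
  next
    case 2
    then have "spider k V y R B'"
      using assms(1) R B by (auto simp: cover_def spider_def)
    then show ?thesis using R B by (intro exI[of _ y] exI[of _ R] exI[of _ B']) auto
  qed
qed

lemma join: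
  assumes "cover k V R B" "R \<noteq> []" "B \<noteq> []" "c (hd R) \<noteq> c (hd B)"
  shows "ham k V (last R) (last B)"
  using join_centre[OF assms] unfolding ham_def by blast

lemma join_rev_left:
  assumes "cover k V R B" "R \<noteq> []" "B \<noteq> []" "c (last R) \<noteq> c (hd B)"
  shows "ham k V (hd R) (last B)"
  using join[OF cover_rev_left[OF assms(1)]] assms by (simp add: hd_rev last_rev)

lemma join_rev_right:
  assumes "cover k V R B" "R \<noteq> []" "B \<noteq> []" "c (hd R) \<noteq> c (last B)"
  shows "ham k V (last R) (hd B)"
  using join[OF cover_rev_right[OF assms(1)]] assms by (simp add: hd_rev last_rev)

lemma join_rev_both:
  assumes "cover k V R B" "R \<noteq> []" "B \<noteq> []" "c (last R) \<noteq> c (last B)"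
  shows "ham k V (hd R) (hd B)"
  using join[OF cover_rev_left[OF cover_rev_right[OF assms(1)]]] assms by (simp add: hd_rev last_rev)

lemma ham_single: "cover k V R [] \<Longrightarrow> R \<noteq> [] \<Longrightarrow> ham k V (last R) (hd R)"
  using spider_ham[of k V "hd R" "tl R" "[]"] by (cases R) (auto simp: cover_def spider_def)

text \<open>Reversing the paths brings any adjacent pair of ends to the heads, where
  \<open>join\<close> applies; if one path is empty, the other is a spider centred at its
  head.\<close>

lemma cover_hamiltonian:
  assumes "cover k V R B" "R \<noteq> [] \<or> B \<noteq> []"
    and "R \<noteq> [] \<Longrightarrow> B \<noteq> [] \<Longrightarrow> c (hd R) \<noteq> c (hd B) \<or> c (last R) \<noteq> c (hd B)
      \<or> c (hd R) \<noteq> c (last B) \<or> c (last R) \<noteq> c (last B)"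
  shows "hamiltonian V"
proof (cases "R = [] \<or> B = []")
  case True
  then show ?thesis
    using assms(1,2) cover_swap[OF assms(1)] ham_single unfolding hamiltonian_def by metis
next
  case False
  then show ?thesis
    using join[OF assms(1)] join_rev_left[OF assms(1)] join_rev_right[OF assms(1)]
      join_rev_both[OF assms(1)] assms(3) unfolding hamiltonian_def by blast
qed

lemma spider_cover: "spider k V w R B \<Longrightarrow> cover k V (w # R) B"
  by (auto simp: spider_def cover_def successively_Cons)

section \<open>Attaching a vertex to a spider\<close>

lemma spider_add:
  assumes "spider k W w R B" "u \<notin> W" "link k u w"
  shows "cover k (insert u W) (u # w # R) B"
  using assms by (auto simp: spider_def cover_def successively_Cons)

text \<open>If no end of \<open>u # w # R\<close> were adjacent to an end of \<open>B\<close>, all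
  four ends would lie in the class of \<open>u\<close>, which \<open>e\<close> excludes.\<close>

lemma attach_link:
  assumes sp: "spider k W w R B" and u: "u \<notin> W" and l: "link k u w"
    and e: "\<not> (c (last (w # R)) = c u \<and> c (last (w # B)) = c u)"
  shows "hamiltonian (insert u W)"
proof (rule cover_hamiltonian[OF spider_add[OF sp u l]])
  assume "B \<noteq> []"
  then show "c (hd (u # w # R)) \<noteq> c (hd B) \<or> c (last (u # w # R)) \<noteq> c (hd B)
      \<or> c (hd (u # w # R)) \<noteq> c (last B) \<or> c (last (u # w # R)) \<noteq> c (last B)"
    using e by auto
qed simp

lemma attach:
  assumes "spider k W w R B" "u \<notin> W" "c w \<noteq> c u"
    and "\<not> (c (last (w # R)) = c u \<and> c (last (w # B)) = c u)"
  shows "hamiltonian (insert u W)"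
proof -
  consider "link k u w" | "link (\<not> k) u w"
    using link_cases assms(3) by metis
  then show ?thesis
    using attach_link[OF assms(1,2)] attach_link[OF spider_swap[OF assms(1)] assms(2)] assms(4)
    by (metis)
qed

text \<open>Joining the two heads gives a spider centred at one of them, and both are adjacent to
  \<open>u\<close>, so \<open>attach\<close> applies in either case.\<close>

lemma attach_cover:
  assumes "cover k W R B" "u \<notin> W" "R \<noteq> []" "B \<noteq> []" "c (hd R) \<noteq> c (hd B)"
    and "c (hd R) \<noteq> c u" "c (hd B) \<noteq> c u"
    and "\<not> (c (last R) = c u \<and> c (last B) = c u)"
  shows "hamiltonian (insert u W)"
  using join_centre[OF assms(1,3,4,5)] attach[OF _ assms(2)] assms(6,7,8) by metis

section \<open>Absorbing a vertex from a class smaller than half\<close>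

text \<open>If the arm \<open>B\<close> did not close up to a cycle through the centre, or had two
  consecutive vertices outside the class of \<open>u\<close>, the spider could be rearranged to have
  its centre outside that class, and \<open>attach\<close> would absorb \<open>u\<close>.\<close>

lemma absorb_side:
  assumes sp: "spider k W w R B" and u: "u \<notin> W" and w: "c w = c u"
    and e: "c (last (w # B)) \<noteq> c u" and no: "\<not> hamiltonian (insert u W)"
  shows "R \<noteq> []" "B \<noteq> []" "link (\<not> k) w (last B)"
    "successively (\<lambda>x y. \<not> (c x \<noteq> c u \<and> c y \<noteq> c u)) B"
proof -
  show B: "B \<noteq> []" using e w by auto
  show R: "R \<noteq> []"
  proof
    assume "R = []"
    \<comment> \<open>Without \<open>R\<close> the spider is a single path, and \<open>u\<close>
      alone serves as the other one.\<close>
    then have "cover k (insert u W) [u] (w # B)"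
      using sp u by (auto simp: cover_def spider_def)
    then have "hamiltonian (insert u W)"
      by (rule cover_hamiltonian) (use e in auto)
    with no show False by blast
  qed
  have hdB: "c (hd B) \<noteq> c u"
    using sp B w by (cases B) (auto simp: spider_def link_def)
  show wl: "link (\<not> k) w (last B)"
  proof (rule ccontr)
    assume "\<not> link (\<not> k) w (last B)"
    then have l: "link k (last B) w"
      using link_cases[of w "last B" k] w e B link_sym by auto
    obtain B' y where By: "B = B' @ [y]" using B by (metis append_butlast_last_id)
    have "spider k W y (w # R) (rev B')"
      using sp l By path_rev[of "\<not> k" "B' @ [y]"]
      by (auto simp: spider_def successively_Cons)
    moreover have "last (y # rev B') = hd B"
      using By by (cases B') auto
    ultimately show False
      using attach[of k W y "w # R" "rev B'" u] u e hdB no By by auto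
  qed
  show "successively (\<lambda>x y. \<not> (c x \<noteq> c u \<and> c y \<noteq> c u)) B"
  proof (rule ccontr)
    assume "\<not> ?thesis"
    then obtain xs x y ys where B4: "B = xs @ x # y # ys" and xy: "c x \<noteq> c u" "c y \<noteq> c u"
      using not_successively_split by blast
    \<comment> \<open>\<open>C\<close> is the closed arm cut open between \<open>x\<close> and
      \<open>y\<close>: it runs from \<open>x\<close> back to the head of \<open>B\<close>, through
      \<open>w\<close> to the last vertex of \<open>B\<close>, and back to \<open>y\<close>.\<close>
    define C where "C = rev (xs @ [x]) @ w # rev (y # ys)"
    have pB: "path (\<not> k) (xs @ [x])" "path (\<not> k) (y # ys)" "link (\<not> k) x y"
      using sp B4 by (auto simp: spider_def successively_Cons successively_append_iff)
    have "link (\<not> k) w (hd B)"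
      using sp B by (cases B) (auto simp: spider_def)
    then have "link (\<not> k) (last (rev (xs @ [x]))) w"
      using B4 link_sym by (cases xs) auto
    moreover have "link (\<not> k) w (hd (rev (y # ys)))"
      using wl B4 by (simp add: hd_rev del: rev.simps)
    ultimately have "path (\<not> k) C"
      unfolding C_def using pB path_rev[of "\<not> k" "xs @ [x]"] path_rev[of "\<not> k" "y # ys"]
      by (auto simp: successively_append_iff successively_Cons simp del: rev.simps rev_append path_flip successively_rev)
    moreover have "path k R"
      using sp R by (cases R) (auto simp: spider_def)
    moreover have "distinct (R @ C)" "set R \<union> set C = W"
      using sp B4 by (auto simp: spider_def C_def)
    ultimately have cov: "cover k W R C"
      by (simp add: cover_def)
    have C: "hd C = x" "last C = y" "C \<noteq> []"
      by (auto simp: C_def last_rev)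
    have r: "c (hd R) \<noteq> c u"
      using sp R w by (cases R) (auto simp: spider_def link_def)
    have "c x \<noteq> c y" using pB(3) link_adj by blast
    then consider "c (hd R) \<noteq> c x" | "c (hd R) \<noteq> c y" by metis
    then show False
    proof cases
      case 1
      then show ?thesis using attach_cover[OF cov u R] C r xy no by auto
    next
      case 2
      then show ?thesis using attach_cover[OF cover_rev_right[OF cov] u R] C r xy no by (auto simp: hd_rev last_rev)
    qed
  qed
qed

text \<open>A centre outside the class of \<open>u\<close> is handled by \<open>attach\<close>.
  Otherwise \<open>absorb_side\<close> makes both arms so sparse outside the class of
  \<open>u\<close> that this class would contain at least half of the vertices, against
  \<open>n\<close>.\<close>

lemma absorb:
  assumes h: "ham k W x y" and u: "u \<notin> W" and e: "\<not> (c x = c u \<and> c y = c u)"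
    and n: "2 * card {z \<in> insert u W. c z = c u} < card (insert u W)"
  shows "hamiltonian (insert u W)"
proof (rule ccontr)
  assume no: "\<not> hamiltonian (insert u W)"
  have key: False if sp: "spider k W w R B" and e1: "c (last (w # B)) \<noteq> c u" and w: "c w = c u"
    for k w R B
  proof -
    note s = absorb_side[OF sp u w e1 no]
    let ?n = "\<lambda>xs. length (filter (\<lambda>z. c z \<noteq> c u) xs)" and ?a = "\<lambda>xs. length (filter (\<lambda>z. c z = c u) xs)"
    have len: "length xs = ?n xs + ?a xs" for xs
      using sum_length_filter_compl[of "\<lambda>z. c z = c u" xs] by simp
    have W: "insert u W = set (u # w # R @ B)" and d: "distinct (u # w # R @ B)"
      using sp u by (auto simp: spider_def)
    have "card (insert u W) = 2 + length R + length B"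
      unfolding W using distinct_card[OF d] by simp
    moreover have "{z \<in> insert u W. c z = c u} = set (filter (\<lambda>z. c z = c u) (u # w # R @ B))"
      unfolding W by auto
    then have "card {z \<in> insert u W. c z = c u} = 2 + ?a R + ?a B"
      using distinct_card[OF distinct_filter[OF d, of "\<lambda>z. c z = c u"]] w by simp
    ultimately have tot: "?a R + ?a B + 2 < ?n R + ?n B"
      using n len[of R] len[of B] by simp
    have nB: "?n B \<le> ?a B + 1"
      using sparse_count[OF s(4) s(2)] by simp
    show False
    proof (cases "c (last R) = c u")
      case False
      then have "successively (\<lambda>x y. \<not> (c x \<noteq> c u \<and> c y \<noteq> c u)) R"
        using absorb_side(4)[OF spider_swap[OF sp] u w _ no] s(1) by auto
      from sparse_count[OF this s(1)] have "?n R \<le> ?a R + 1" by simp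
      then show False using tot nB by simp
    next
      case True
      obtain R' r where Rr: "R = R' @ [r]" using s(1) by (metis append_butlast_last_id)
      have r: "c r = c u" using True Rr by simp
      then have R': "R' \<noteq> []" using sp Rr w by (auto simp: spider_def link_def)
      obtain B' y where By: "B = B' @ [y]" using s(2) by (metis append_butlast_last_id)
      have y: "c y \<noteq> c u" using e1 By by simp
      have hdB: "c (hd B) \<noteq> c u"
        using sp s(2) w by (cases B) (auto simp: spider_def link_def)
      have rR': "c (last R') \<noteq> c u"
        using sp R' Rr r by (auto simp: spider_def link_def successively_Cons successively_append_iff)
      \<comment> \<open>This colour allows \<open>r\<close> to move from the end of \<open>R\<close>
        to the end of \<open>B\<close>. The shortened arm \<open>R'\<close> ends outside the class
        of \<open>u\<close>, so \<open>absorb_side\<close> applies to it.\<close>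
      have "link (\<not> k) y r"
      proof (rule ccontr)
        assume "\<not> link (\<not> k) y r"
        then have "link k y r" using link_cases[of y r k] y r by auto
        then have "spider k W y (rev (w # R)) (rev B')"
          using sp Rr By path_rev[of "\<not> k" "B' @ [y]"] path_rev[of k "w # R"]
          by (auto simp: spider_def successively_Cons)
        moreover have "last (y # rev B') = hd B"
          using By by (cases B') auto
        ultimately show False
          using attach[of k W y "rev (w # R)" "rev B'" u] u y hdB no by auto
      qed
      then have "path (\<not> k) ((w # B) @ [r])"
        using sp By by (subst successively_append_iff) (auto simp: spider_def)
      then have sp2: "spider k W w R' (B @ [r])"
        using sp Rr by (auto simp: spider_def successively_append_iff successively_Cons)
      have "c (last (w # R')) \<noteq> c u" using R' rR' by simp
      note absorb_side(4)[OF spider_swap[OF sp2] u w this no]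
      from sparse_count[OF this R'] have "?n R' \<le> ?a R' + 1" by simp
      moreover have "?n R = ?n R'" "?a R = ?a R' + 1" using Rr r by auto
      ultimately show False using tot nB by simp
    qed
  qed
  obtain w R B where sp: "spider k W w R B" and l: "last (w # R) = x" "last (w # B) = y"
    using h by (auto simp: ham_def)
  have w: "c w = c u"
    using attach[OF sp u] no e l by metis
  show False
    using key[OF sp _ w] key[OF spider_swap[OF sp] _ w] e l by metis
qed

section \<open>Where spiders can end while vertices are missing\<close>

text \<open>\<open>v\<close> is put in front of the centre, and each claim with \<open>B\<close>
  non-empty joins the longer path to \<open>B\<close> at a different pair of ends.\<close>

lemma add_ends:
  assumes "spider k W w R B" "v \<notin> W" "link k v w"
  shows "B = [] \<Longrightarrow> ham k (insert v W) (last (w # R)) v"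
    "B \<noteq> [] \<Longrightarrow> c v \<noteq> c (hd B) \<Longrightarrow> ham k (insert v W) (last (w # R)) (last B)"
    "B \<noteq> [] \<Longrightarrow> c (last (w # R)) \<noteq> c (hd B) \<Longrightarrow> ham k (insert v W) v (last B)"
    "B \<noteq> [] \<Longrightarrow> c (last (w # R)) \<noteq> c (last B) \<Longrightarrow> ham k (insert v W) v (hd B)"
proof -
  note cov = spider_add[OF assms]
  show "B = [] \<Longrightarrow> ham k (insert v W) (last (w # R)) v"
    using ham_single cov by fastforce
  show "B \<noteq> [] \<Longrightarrow> c v \<noteq> c (hd B) \<Longrightarrow> ham k (insert v W) (last (w # R)) (last B)"
    using join[OF cov] by auto
  show "B \<noteq> [] \<Longrightarrow> c (last (w # R)) \<noteq> c (hd B) \<Longrightarrow> ham k (insert v W) v (last B)"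
    using join_rev_left[OF cov] by auto
  show "B \<noteq> [] \<Longrightarrow> c (last (w # R)) \<noteq> c (last B) \<Longrightarrow> ham k (insert v W) v (hd B)"
    using join_rev_both[OF cov] by auto
qed

text \<open>Information about ends is passed from a set to the set with one vertex less:
  \<open>N\<close> collects the classes in which spiders on \<open>insert v W\<close> may end, and
  any other behaviour on \<open>W\<close> would show up in \<open>add_ends\<close>.\<close>

lemma ends_step:
  assumes sp: "spider k W w R B" and v: "v \<notin> W" "c v \<notin> N" "c w \<noteq> c v"
    and allowed: "\<And>k x y. ham k (insert v W) x y \<Longrightarrow> c x = c y \<and> c x \<in> N"
  shows "c (last (w # R)) = c (last (w # B)) \<and> c (last (w # R)) \<in> insert (c v) N"
proof -
  have *: "c (last (w # R)) = c (last (w # B)) \<and> c (last (w # R)) \<in> insert (c v) N"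
    if sp: "spider k W w R B" and l: "link k v w" for k R B
  proof -
    note a = add_ends[OF sp v(1) l]
    have B: "B \<noteq> []" using a(1) allowed v(2) by metis
    \<comment> \<open>The last two claims would put an end at \<open>v\<close>, so both ends of
      \<open>B\<close> share the class of \<open>last (w # R)\<close>. Either this is the class of
      \<open>v\<close>, or the claim keeping the old ends puts it into \<open>N\<close>.\<close>
    show ?thesis
      using a(2-4)[OF B] allowed v(2) B by (metis insertCI last_ConsR)
  qed
  consider "link k v w" | "link (\<not> k) v w"
    using link_cases v(3) by metis
  then show ?thesis
    using *[OF sp] *[OF spider_swap[OF sp]] by cases auto
qed

end

section \<open>Three missing vertices, one from each class\<close>

text \<open>The configuration left after removing \<open>a\<close>, \<open>b\<close>, \<open>d\<close> from a smallest counterexample; it is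
  shown to be contradictory when a spider on \<open>W\<close> has both ends in the class of \<open>a\<close>.\<close>

locale three_missing = two_colouring c E for c :: "'a \<Rightarrow> 'b" and E :: "'a \<Rightarrow> 'a \<Rightarrow> bool" +
  fixes W :: "'a set" and a b d :: 'a
  assumes out: "a \<notin> W" "b \<notin> W" "d \<notin> W"
    and classes: "c a \<noteq> c b" "c a \<noteq> c d" "c b \<noteq> c d" "c ` W \<subseteq> {c a, c b, c d}"
    and miss_a: "ham k (insert b (insert d W)) x y \<Longrightarrow> c x = c a \<and> c y = c a"
    and miss_b: "ham k (insert a (insert d W)) x y \<Longrightarrow> c x = c b \<and> c y = c b"
    and miss_d: "ham k (insert a (insert b W)) x y \<Longrightarrow> c x = c d \<and> c y = c d"
    and miss_ab: "ham k (insert d W) x y \<Longrightarrow> c x = c y \<and> c x \<in> {c a, c b}"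
    and miss_ad: "ham k (insert b W) x y \<Longrightarrow> c x = c y \<and> c x \<in> {c a, c d}"
    and miss_bd: "ham k (insert a W) x y \<Longrightarrow> c x = c y \<and> c x \<in> {c b, c d}"
    and no_ham: "\<not> hamiltonian (insert a (insert b (insert d W)))"
begin

lemma neq: "a \<noteq> b" "a \<noteq> d" "b \<noteq> d"
  using classes by auto

text \<open>With \<open>b\<close> in front of the centre only \<open>a\<close> and \<open>d\<close>
  are missing, so by \<open>miss_ad\<close> no spider from \<open>add_ends\<close> may end at
  \<open>b\<close>. This rules out an empty \<open>B\<close> and a head of \<open>B\<close> in the
  class of \<open>b\<close>.\<close>

lemma centre_same_link:
  assumes sp: "spider k W w R B" and w: "c w = c a"
    and e: "c (last (w # R)) = c a" "c (last (w # B)) = c a" and l: "link k b w"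
  shows "B \<noteq> []" "c (hd B) = c d"
proof -
  note ad = add_ends[OF sp out(2) l]
  show B: "B \<noteq> []" using ad(1) miss_ad classes by fastforce
  then have "hd B \<in> W" "c (hd B) \<noteq> c a"
    using sp w by (cases B; auto simp: spider_def link_def)+
  moreover have "c (hd B) \<noteq> c b"
    using ad(3)[OF B] miss_ad e classes by fastforce
  ultimately show "c (hd B) = c d" using classes(4) by auto
qed

text \<open>Whatever its colour, the edge between \<open>b\<close> and \<open>d\<close> puts both in
  front of the centre on a single path. The resulting spider misses only \<open>a\<close> but ends
  in the class of \<open>b\<close> or \<open>d\<close>.\<close>

lemma centre_same_mixed:
  assumes sp: "spider k W w R B" and w: "c w = c a"
    and e: "c (last (w # R)) = c a" "c (last (w # B)) = c a"
    and l: "link k b w" "link (\<not> k) d w"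
    and B: "B \<noteq> []" "c (hd B) = c d" and R: "R \<noteq> []" "c (hd R) = c b"
  shows False
proof -
  have pR: "path k R" using sp by (auto simp: spider_def successively_Cons)
  have pB: "path (\<not> k) B" using sp by (auto simp: spider_def successively_Cons)
  consider "link (\<not> k) b d" | "link k d b"
    using link_cases[of b d k] classes link_sym by metis
  then show False
  proof cases
    case 1
    then have "cover k (insert b (insert d W)) R (b # d # w # B)"
      using sp l(2) out neq pR by (auto simp: spider_def cover_def)
    from join_rev_left[OF this R(1)] have "ham k (insert b (insert d W)) (hd R) (last (b # d # w # B))"
      using e R classes by auto
    from miss_a[OF this] show False using R classes by auto
  next
    case 2
    then have "cover k (insert b (insert d W)) (d # b # w # R) B"
      using sp l(1) out neq pB by (auto simp: spider_def cover_def)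
    from join_rev_right[OF this _ B(1)] have "ham k (insert b (insert d W)) (last (d # b # w # R)) (hd B)"
      using e B classes by auto
    from miss_a[OF this] show False using B classes by auto
  qed
qed

text \<open>The colours of the edges among \<open>a\<close>, \<open>b\<close>, \<open>d\<close>, the
  centre and the two heads are forced one by one, because each wrong colour produces a spider
  forbidden by a \<open>miss\<close> assumption or by \<open>no_ham\<close>. The forced colours
  together then produce one as well.\<close>

lemma centre_other:
  assumes sp: "spider k W w R B" and w: "c w = c b"
    and e: "c (last (w # R)) = c a" "c (last (w # B)) = c a" and l: "link k a w"
  shows False
proof -
  have ne: "R \<noteq> []" "B \<noteq> []" using e w classes by auto
  have "c (hd B) = c a"
    using add_ends(2)[OF sp out(1) l ne(2)] miss_bd e ne classes by fastforce
  then obtain y B' where B: "B = y # B'" and y: "c y = c a" using ne by (cases B) auto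
  obtain r R' where R: "R = r # R'" using ne by (cases R) auto
  have lR: "c (last R) = c a" and lB: "c (last B) = c a" using e ne by auto
  have rb: "c r \<noteq> c b" using sp R w by (auto simp: spider_def link_def)
  have pR: "path k R" "path k (w # R)" and pB: "path (\<not> k) B" "path (\<not> k) (w # B)"
    using sp by (auto simp: spider_def successively_Cons)
  have notin: "w \<in> W" "set R \<subseteq> W" "set B \<subseteq> W" using sp by (auto simp: spider_def)
  have by_k: "link k b y"
  proof (rule ccontr)
    assume "\<not> link k b y"
    then have "link (\<not> k) b y" using link_cases[of b y k] y classes by auto
    then have "cover k (insert b W) (w # R) (b # B)"
      using sp out pR pB B by (auto simp: spider_def cover_def)
    from join_rev_left[OF this] have "ham k (insert b W) w (last B)"
      using e ne classes by auto
    from miss_ad[OF this] show False using w lB classes by auto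
  qed
  have dy_k: "link k d y"
  proof (rule ccontr)
    assume "\<not> link k d y"
    then have "link (\<not> k) d y" using link_cases[of d y k] y classes by auto
    then have "cover k (insert d W) (w # R) (d # B)"
      using sp out pR pB B by (auto simp: spider_def cover_def)
    from join_rev_left[OF this] have "ham k (insert d W) w (last B)"
      using e ne classes by auto
    from miss_ab[OF this] show False using w lB classes by auto
  qed
  have rb_nk: "link (\<not> k) r b"
  proof (rule ccontr)
    assume "\<not> link (\<not> k) r b"
    then have "link k b r" using link_cases[of r b k] rb link_sym by auto
    then have "cover k (insert b W) (b # R) (w # B)"
      using sp out pR pB R by (auto simp: spider_def cover_def)
    from join_rev_right[OF this] have "ham k (insert b W) (last R) w"
      using e ne classes by auto
    from miss_ad[OF this] show False using w lR classes by auto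
  qed
  have ab_nk: "link (\<not> k) b a"
  proof (rule ccontr)
    assume "\<not> link (\<not> k) b a"
    then have "link k b a" using link_cases[of b a k] classes by auto
    then have "cover k (insert a (insert b W)) (b # a # w # R) B"
      using sp l out pR pB neq by (auto simp: spider_def cover_def)
    from join[OF this _ ne(2)] have "ham k (insert a (insert b W)) (last R) (last B)"
      using ne B y classes by auto
    from miss_d[OF this] show False using lR classes by auto
  qed
  have ad_nk: "link (\<not> k) a d"
  proof (rule ccontr)
    assume "\<not> link (\<not> k) a d"
    then have "link k d a" using link_cases[of a d k] classes link_sym by auto
    then have "cover k (insert a (insert d W)) (d # a # w # R) B"
      using sp l out pR pB neq by (auto simp: spider_def cover_def)
    from join[OF this _ ne(2)] have "ham k (insert a (insert d W)) (last R) (last B)"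
      using ne B y classes by auto
    from miss_b[OF this] show False using lR classes by auto
  qed
  have "link k d w"
  proof (rule ccontr)
    assume "\<not> link k d w"
    then have "link (\<not> k) d w" using link_cases[of d w k] w classes by auto
    then have "spider k (insert a (insert b (insert d W))) r R' (b # a # d # w # B)"
      using sp R pR(1) pB(2) rb_nk ab_nk ad_nk out neq by (auto simp: spider_def)
    then show False using spider_ham no_ham unfolding hamiltonian_def by blast
  qed
  \<comment> \<open>The head \<open>y\<close> of \<open>B\<close> now sits between \<open>b\<close>
    and \<open>d\<close> on the path of colour \<open>k\<close>, so only \<open>B'\<close> and
    \<open>a\<close> remain to be placed.\<close>
  then have pl: "path k (b # y # d # w # R)"
    using by_k dy_k link_sym pR by auto
  show False
  proof (cases "B' = []")
    case True
    then have "cover k (insert a (insert b (insert d W))) (b # y # d # w # R) [a]"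
      using pl sp B out neq by (auto simp: spider_def cover_def)
    then have "hamiltonian (insert a (insert b (insert d W)))"
      by (rule cover_hamiltonian) (use classes in auto)
    then show False using no_ham by blast
  next
    case False
    have "cover k (insert b (insert d W)) (b # y # d # w # R) B'"
      using pl sp B out neq pB(1) by (auto simp: spider_def cover_def successively_Cons)
    from join_rev_right[OF this _ False] have "ham k (insert b (insert d W)) (last R) (hd B')"
      using ne lB B False classes by auto
    from miss_a[OF this] show False
      using pB(1) B y False by (cases B') (auto simp: link_def)
  qed
qed

text \<open>The roles of \<open>b\<close> and \<open>d\<close> are symmetric; facts prefixed with
  \<open>s\<close> below are the mirrored ones.\<close>

lemma swapped: "three_missing c E W a d b"
proof (unfold_locales, goal_cases)
  case (8 k x y)
  then show ?case using miss_a by (simp add: insert_commute)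
next
  case (9 k x y)
  then show ?case using miss_d by blast
next
  case (10 k x y)
  then show ?case using miss_b by blast
next
  case (11 k x y)
  then show ?case using miss_ad by blast
next
  case (12 k x y)
  then show ?case using miss_ab by blast
next
  case (13 k x y)
  then show ?case using miss_bd by blast
next
  case 14
  then show ?case using no_ham by (simp add: insert_commute)
qed (use out classes in auto)

text \<open>The cases follow the class of the centre. In the class of \<open>a\<close>, edges of
  equal colour to \<open>b\<close> and \<open>d\<close> force the head of one arm into two classes
  at once; different colours are the mixed case.\<close>

lemma no_same_ends:
  assumes h: "ham k W x y" and e: "c x = c a" "c y = c a"
  shows False
proof -
  interpret s: three_missing c E W a d b by (rule swapped)
  obtain w R B where sp: "spider k W w R B" and xy: "last (w # R) = x" "last (w # B) = y"
    using h by (auto simp: ham_def)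
  note sp' = spider_swap[OF sp]
  have e1: "c (last (w # R)) = c a" and e2: "c (last (w # B)) = c a" using e xy by auto
  have "w \<in> W" using sp by (auto simp: spider_def)
  then consider "c w = c a" | "c w = c b" | "c w = c d" using classes(4) by auto
  then show False
  proof cases
    case 1
    note ca = 1
    have "link k b w \<or> link (\<not> k) b w" "link k d w \<or> link (\<not> k) d w"
      using link_cases ca classes by metis+
    then consider "link k b w" "link k d w" | "link (\<not> k) b w" "link (\<not> k) d w"
      | "link k b w" "link (\<not> k) d w" | "link (\<not> k) b w" "link k d w"
      by blast
    then show False
    proof cases
      case 1
      then show False
        using centre_same_link(2)[OF sp ca e1 e2] s.centre_same_link(2)[OF sp ca e1 e2] classes by auto
    next
      case 2
      then show False
        using centre_same_link(2)[OF sp' ca e2 e1] s.centre_same_link(2)[OF sp' ca e2 e1] classes by auto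
    next
      case 3
      show False
        using centre_same_mixed[OF sp ca e1 e2 3] centre_same_link[OF sp ca e1 e2 3(1)]
          s.centre_same_link[OF sp' ca e2 e1 3(2)] by blast
    next
      case 4
      then show False
        using centre_same_mixed[OF sp' ca e2 e1 4(1)] centre_same_link[OF sp' ca e2 e1 4(1)]
          s.centre_same_link[OF sp ca e1 e2 4(2)] by auto
    qed
  next
    case 2
    have "link k a w \<or> link (\<not> k) a w" using link_cases 2 classes by metis
    then show False
      using centre_other[OF sp 2 e1 e2] centre_other[OF sp' 2 e2 e1] by blast
  next
    case 3
    have "link k a w \<or> link (\<not> k) a w" using link_cases 3 classes by metis
    then show False
      using s.centre_other[OF sp 3 e1 e2] s.centre_other[OF sp' 3 e2 e1] by blast
  qed
qed

end

section \<open>Three classes, each leaving a slack of at least two\<close>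

context two_colouring
begin

definition class_of :: "'a set \<Rightarrow> 'a \<Rightarrow> 'a set" where
  "class_of V x = {z \<in> V. c z = c x}"

lemma card_three_classes:
  assumes "finite V" "c ` V = {c a, c b, c d}" "c a \<noteq> c b" "c a \<noteq> c d" "c b \<noteq> c d"
  shows "card V = card (class_of V a) + card (class_of V b) + card (class_of V d)"
proof -
  have "V = class_of V a \<union> class_of V b \<union> class_of V d"
    using assms(2) by (auto simp: class_of_def)
  also have "card \<dots> = card (class_of V a \<union> class_of V b) + card (class_of V d)"
    by (rule card_Un_disjoint) (use assms in \<open>auto simp: class_of_def\<close>)
  also have "card (class_of V a \<union> class_of V b) = card (class_of V a) + card (class_of V b)"
    by (rule card_Un_disjoint) (use assms in \<open>auto simp: class_of_def\<close>)
  finally show ?thesis .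
qed

lemma three_representatives:
  assumes "card (c ` V) = 3"
  obtains a b d where "a \<in> V" "b \<in> V" "d \<in> V" "c ` V = {c a, c b, c d}"
    "c a \<noteq> c b" "c a \<noteq> c d" "c b \<noteq> c d"
proof -
  obtain p q r where pqr: "c ` V = {p, q, r}" "p \<noteq> q" "p \<noteq> r" "q \<noteq> r"
    using assms by (auto simp: card_3_iff)
  then have "p \<in> c ` V" "q \<in> c ` V" "r \<in> c ` V" by auto
  then show ?thesis using that pqr by (metis imageE)
qed

text \<open>In a counterexample, \<open>absorb\<close> confines the ends when one vertex is missing,
  and \<open>ends_step\<close> carries this on to two and three missing vertices. The spider that
  \<open>IH\<close> gives for three missing vertices then contradicts
  \<open>no_same_ends\<close>.\<close>

lemma slack_two:
  assumes fin: "finite V" and three: "card (c ` V) = 3"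
    and slack: "\<And>x. x \<in> V \<Longrightarrow> 2 * card (class_of V x) + 2 \<le> card V"
    and IH: "\<And>W. W \<subset> V \<Longrightarrow> card (c ` W) = 3 \<Longrightarrow>
      (\<And>x. x \<in> W \<Longrightarrow> 2 * card (class_of W x) \<le> card W) \<Longrightarrow> hamiltonian W"
  shows "hamiltonian V"
proof (rule ccontr)
  assume no: "\<not> hamiltonian V"
  have miss1: "c x = c u \<and> c y = c u" if "ham k (V - {u}) x y" "u \<in> V" for k u x y
  proof (rule ccontr)
    assume "\<not> (c x = c u \<and> c y = c u)"
    moreover have "insert u (V - {u}) = V" using that by auto
    ultimately show False
      using absorb[OF that(1), of u] slack[OF that(2)] no by (auto simp: class_of_def)
  qed
  have miss2: "c x = c y \<and> c x \<in> {c u, c v}"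
    if h: "ham k (V - {u, v}) x y" and uv: "u \<in> V" "v \<in> V" "c u \<noteq> c v" for k u v x y
  proof -
    obtain w R B where sp: "spider k (V - {u, v}) w R B"
      and xy: "last (w # R) = x" "last (w # B) = y"
      using h by (auto simp: ham_def)
    have ins: "insert u (V - {u, v}) = V - {v}" "insert v (V - {u, v}) = V - {u}" using uv by auto
    show ?thesis
    \<comment> \<open>The centre avoids the class of \<open>u\<close> or that of \<open>v\<close>;
      the vertex whose class it avoids is put back.\<close>
    proof (cases "c w = c u")
      case False
      have "c (last (w # R)) = c (last (w # B)) \<and> c (last (w # R)) \<in> insert (c u) {c v}"
        by (rule ends_step[OF sp]) (use False uv miss1 in \<open>auto simp: ins\<close>)
      then show ?thesis using xy by auto
    next
      case True
      have "c (last (w # R)) = c (last (w # B)) \<and> c (last (w # R)) \<in> insert (c v) {c u}"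
        by (rule ends_step[OF sp]) (use True uv miss1 in \<open>auto simp: ins\<close>)
      then show ?thesis using xy by auto
    qed
  qed
  have tm: "three_missing c E (V - {a, b, d}) a b d"
    if "a \<in> V" "b \<in> V" "d \<in> V" "c ` V = {c a, c b, c d}"
      "c a \<noteq> c b" "c a \<noteq> c d" "c b \<noteq> c d" for a b d
  proof -
    have "a \<noteq> b" "a \<noteq> d" "b \<noteq> d" using that(5-7) by auto
    have eqs: "insert d (V - {a, b, d}) = V - {a, b}" "insert b (V - {a, b, d}) = V - {a, d}"
      "insert a (V - {a, b, d}) = V - {b, d}" "insert b (V - {a, b}) = V - {a}"
      "insert a (V - {a, b}) = V - {b}" "insert a (V - {a, d}) = V - {d}" "insert a (V - {a}) = V"
      using that(1-3) \<open>a \<noteq> b\<close> \<open>a \<noteq> d\<close> \<open>b \<noteq> d\<close> by auto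
    show ?thesis
    proof (unfold_locales, unfold eqs, goal_cases)
      case (8 k x y)
      then show ?case using miss1 that by blast
    next
      case (9 k x y)
      then show ?case using miss1 that by blast
    next
      case (10 k x y)
      then show ?case using miss1 that by blast
    next
      case (11 k x y)
      then show ?case using miss2 that by blast
    next
      case (12 k x y)
      then show ?case using miss2 that by blast
    next
      case (13 k x y)
      then show ?case using miss2 that by blast
    qed (use that no in auto)
  qed
  obtain a b d where abd: "a \<in> V" "b \<in> V" "d \<in> V" "c ` V = {c a, c b, c d}"
    "c a \<noteq> c b" "c a \<noteq> c d" "c b \<noteq> c d"
    using three_representatives[OF three] .
  define W where "W = V - {a, b, d}"
  note n = card_three_classes[OF fin abd(4-7)]
  have cl: "class_of W a = class_of V a - {a}" "class_of W b = class_of V b - {b}"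
    "class_of W d = class_of V d - {d}"
    using abd by (auto simp: class_of_def W_def)
  have mem: "a \<in> class_of V a" "b \<in> class_of V b" "d \<in> class_of V d" "finite (class_of V x)" for x
    using abd fin by (auto simp: class_of_def)
  have cc: "card (class_of W a) = card (class_of V a) - 1" "card (class_of W b) = card (class_of V b) - 1"
    "card (class_of W d) = card (class_of V d) - 1"
    using cl mem by auto
  \<comment> \<open>Adding the slack inequalities of two classes bounds the third from below by two,
    so \<open>W\<close> still meets every class.\<close>
  have ge: "card (class_of V a) \<ge> 2" "card (class_of V b) \<ge> 2" "card (class_of V d) \<ge> 2"
    using slack[OF abd(1)] slack[OF abd(2)] slack[OF abd(3)] n by auto
  have "card (class_of W a) \<noteq> 0" "card (class_of W b) \<noteq> 0" "card (class_of W d) \<noteq> 0"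
    using cc ge by auto
  then have "class_of W a \<noteq> {}" "class_of W b \<noteq> {}" "class_of W d \<noteq> {}"
    by auto
  moreover have "c z \<in> c ` W" if "class_of W z \<noteq> {}" for z
    using that by (auto simp: class_of_def) (metis imageI)
  ultimately have "{c a, c b, c d} \<subseteq> c ` W" by auto
  then have cW: "c ` W = {c a, c b, c d}" using abd(4) W_def by auto
  have finW: "finite W" using fin W_def by auto
  note nW = card_three_classes[OF finW cW abd(5-7)]
  have "hamiltonian W"
  proof (rule IH)
    show "W \<subset> V" using abd W_def by auto
    show "card (c ` W) = 3" using cW abd by auto
    fix x assume "x \<in> W"
    then have "c x \<in> {c a, c b, c d}" using cW by auto
    then have "class_of W x \<in> {class_of W a, class_of W b, class_of W d}"
      unfolding class_of_def by auto
    then show "2 * card (class_of W x) \<le> card W"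
      using nW n cc ge slack[OF abd(1)] slack[OF abd(2)] slack[OF abd(3)] by auto
  qed
  then obtain k x y where h: "ham k W x y" by (auto simp: hamiltonian_def)
  obtain w R B where sp: "spider k W w R B" and xy: "last (w # R) = x" "last (w # B) = y"
    using h by (auto simp: ham_def)
  have "w \<in> W" using sp by (auto simp: spider_def)
  have ins: "insert a W = V - {b, d}" "insert b W = V - {a, d}"
    using abd by (auto simp: W_def)
  have "c x = c y \<and> c x \<in> {c a, c b, c d}"
  proof (cases "c w = c a")
    case False
    have al: "c x = c y \<and> c x \<in> {c b, c d}" if "ham k (insert a W) x y" for k x y
      using miss2[of k b d x y] that[unfolded ins] abd by blast
    have "c (last (w # R)) = c (last (w # B)) \<and> c (last (w # R)) \<in> insert (c a) {c b, c d}"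
      by (rule ends_step[OF sp _ _ _ al]) (use False abd in \<open>auto simp: W_def\<close>)
    then show ?thesis using xy by auto
  next
    case True
    have al: "c x = c y \<and> c x \<in> {c a, c d}" if "ham k (insert b W) x y" for k x y
      using miss2[of k a d x y] that[unfolded ins] abd by blast
    have "c (last (w # R)) = c (last (w # B)) \<and> c (last (w # R)) \<in> insert (c b) {c a, c d}"
      by (rule ends_step[OF sp _ _ _ al]) (use True abd in \<open>auto simp: W_def\<close>)
    then show ?thesis using xy by auto
  qed
  \<comment> \<open>\<open>no_same_ends\<close> concerns the class of its first vertex, so
    \<open>tm\<close> is used with each of the three vertices in first place.\<close>
  then consider "c x = c a" "c y = c a" | "c x = c b" "c y = c b" | "c x = c d" "c y = c d"
    by auto
  then show False
  proof cases
    case 1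
    then show False
      using three_missing.no_same_ends[OF tm[OF abd]] h W_def by blast
  next
    case 2
    have "c ` V = {c b, c a, c d}" "ham k (V - {b, a, d}) x y"
      using abd(4) h by (simp_all add: W_def insert_commute)
    then show False
      using three_missing.no_same_ends[OF tm[of b a d]] abd(1-3,5-7) 2 by metis
  next
    case 3
    have "c ` V = {c d, c a, c b}" "ham k (V - {d, a, b}) x y"
      using abd(4) h by (simp_all add: W_def insert_commute)
    then show False
      using three_missing.no_same_ends[OF tm[of d a b]] abd(1-3,5-7) 3 by metis
  qed
qed

section \<open>Counting along spiders, and split colourings\<close>

text \<open>Read from end to end, a spider is a list whose neighbours lie in different classes, so
  vertices of class \<open>t\<close> are never consecutive and \<open>sparse_count\<close>
  applies.\<close>

lemma ham_count:
  assumes "ham k V x y"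
  shows "card {z \<in> V. c z = t} + of_bool (c x \<noteq> t) + of_bool (c y \<noteq> t) \<le> card {z \<in> V. c z \<noteq> t} + 1"
proof -
  obtain w R B where sp: "spider k V w R B" and xy: "last (w # R) = x" "last (w # B) = y"
    using assms by (auto simp: ham_def)
  define L where "L = rev R @ w # B"
  have p: "path k (w # R)" "path (\<not> k) (w # B)" using sp by (auto simp: spider_def)
  have "successively (\<lambda>x y. c x \<noteq> c y) (w # R)" "successively (\<lambda>x y. c x \<noteq> c y) (w # B)"
    by (rule successively_mono[OF p(1)], simp add: link_def)
      (rule successively_mono[OF p(2)], simp add: link_def)
  moreover have "(\<lambda>x y. c y \<noteq> c x) = (\<lambda>x y. c x \<noteq> c y)" by (intro ext) auto
  ultimately have "successively (\<lambda>x y. c x \<noteq> c y) (rev (w # R))" "successively (\<lambda>x y. c x \<noteq> c y) (w # B)"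
    by (simp_all only: successively_rev)
  then have "successively (\<lambda>x y. c x \<noteq> c y) L"
    unfolding L_def rev.simps successively_append_iff successively_Cons by simp
  then have sc: "successively (\<lambda>x y. \<not> (c x = t \<and> c y = t)) L"
    by (rule successively_mono) auto
  have L: "L \<noteq> []" "hd L = x" "last L = y" "distinct L" "set L = V"
    using sp xy by (auto simp: L_def spider_def hd_append hd_rev)
  have "card {z \<in> V. Q z} = length (filter Q L)" for Q
    using distinct_card[OF distinct_filter[OF L(4), of Q]] unfolding set_filter L(5) by blast
  then show ?thesis
    using sparse_count[OF sc L(1)] L by simp
qed

lemma alternating_path:
  assumes "finite X" "finite Y" "card X = card Y" "x \<in> X" "X \<inter> Y = {}"
    and "\<And>x y. x \<in> X \<Longrightarrow> y \<in> Y \<Longrightarrow> link k x y"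
  shows "\<exists>L. path k L \<and> distinct L \<and> set L = X \<union> Y \<and> L \<noteq> [] \<and> hd L = x \<and> last L \<in> Y"
  using assms
proof (induction "card X" arbitrary: X Y x)
  case 0
  then show ?case by auto
next
  case (Suc n)
  then have "Y \<noteq> {}" by auto
  then obtain y where y: "y \<in> Y" by auto
  show ?case
  proof (cases "X = {x}")
    case True
    then have "Y = {y}" using Suc y by (metis card_1_singletonE card.empty card_insert_disjoint finite.emptyI insert_absorb insert_not_empty singletonD One_nat_def empty_iff)
    then show ?thesis using True Suc.prems by (intro exI[of _ "[x, y]"]) auto
  next
    case False
    then obtain x' where x': "x' \<in> X - {x}" using Suc.prems by auto
    have "n = card (X - {x})" "card (X - {x}) = card (Y - {y})" "(X - {x}) \<inter> (Y - {y}) = {}"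
      using Suc y by auto
    then obtain L where L: "path k L" "distinct L" "set L = (X - {x}) \<union> (Y - {y})" "L \<noteq> []"
      "hd L = x'" "last L \<in> Y - {y}"
      using Suc.hyps(1)[of "X - {x}" "Y - {y}" x'] Suc.prems x' by auto
    have "link k x y" "link k y x'"
      using Suc.prems y x' link_sym by blast+
    then show ?thesis
      using L Suc.prems y by (intro exI[of _ "x # y # L"]) (auto simp: successively_Cons)
  qed
qed

text \<open>Between the two sides, each colour forms two complete bipartite pieces. The edge between
  \<open>y1\<close> and \<open>y2\<close> connects the two pieces of its colour \<open>k\<close>
  into one path, chosen so that the leftover is a balanced part of one piece of the other
  colour.\<close>

lemma split_hamiltonian:
  fixes p g :: "'a \<Rightarrow> bool"
  assumes fin: "finite V" and adj: "\<And>x y. p x \<noteq> p y \<Longrightarrow> c x \<noteq> c y"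
    and bal: "card {x \<in> V. p x} = card {x \<in> V. \<not> p x}"
    and split: "\<And>x y. x \<in> V \<Longrightarrow> y \<in> V \<Longrightarrow> p x \<noteq> p y \<Longrightarrow> E x y = (g x = g y)"
    and ne: "\<And>b. \<exists>x \<in> V. p x \<and> g x = b"
    and y: "y1 \<in> V" "y2 \<in> V" "\<not> p y1" "\<not> p y2" "g y1 \<noteq> g y2" "c y1 \<noteq> c y2"
  shows "hamiltonian V"
proof -
  define k where "k = E y1 y2"
  \<comment> \<open>Relabelling the side \<open>p\<close> by \<open>l\<close> makes colour
    \<open>k\<close> join pieces of equal index, whichever colour \<open>k\<close> is.\<close>
  define l where "l = (\<lambda>x. g x = k)"
  define A where "A = (\<lambda>b. {x \<in> V. p x \<and> l x = b})"
  define Y where "Y = (\<lambda>b. {x \<in> V. \<not> p x \<and> g x = b})"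
  have finA: "finite (A b)" "finite (Y b)" for b using fin by (auto simp: A_def Y_def)
  have lk: "link k y x" "link k x y" if "x \<in> A b" "y \<in> Y b" for x y b
    using that adj[of x y] split[of x y] link_sym[of k x y] by (auto simp: A_def Y_def l_def link_def)
  have lnk: "link (\<not> k) y x" if "x \<in> A b" "y \<in> Y (\<not> b)" for x y b
    using that adj[of y x] split[of y x] by (auto simp: A_def Y_def l_def link_def)
  have AY: "A b \<inter> Y b' = {}" for b b' by (auto simp: A_def Y_def)
  have "{x \<in> V. p x} = A b \<union> A (\<not> b)" "{x \<in> V. \<not> p x} = Y b \<union> Y (\<not> b)"
    "A b \<inter> A (\<not> b) = {}" "Y b \<inter> Y (\<not> b) = {}" for b
    by (auto simp: A_def Y_def)
  then have sum: "card (A b) + card (A (\<not> b)) = card (Y b) + card (Y (\<not> b))" for b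
    using bal finA by (metis card_Un_disjoint)
  have V: "A b \<union> A (\<not> b) \<union> Y b \<union> Y (\<not> b) = V" for b
    by (auto simp: A_def Y_def)
  \<comment> \<open>With this \<open>b\<close> the vertices left over by balanced
    \<open>k\<close>-paths lie in \<open>A b\<close> and \<open>Y (\<not> b)\<close>, which are
    joined by the other colour.\<close>
  obtain b where b: "card (Y b) \<le> card (A b)"
    using sum[of True] by (metis add_le_mono linorder_not_le nat_le_linear add_less_mono order_less_irrefl)
  obtain z1 z2 where z: "z1 \<in> Y b" "z2 \<in> Y (\<not> b)" "link k z1 z2"
  proof (cases "g y1 = b")
    case True
    then show thesis using that[of y1 y2] y by (auto simp: Y_def link_def k_def)
  next
    case False
    then show thesis using that[of y2 y1] y by (auto simp: Y_def link_def k_def E_sym)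
  qed
  obtain A' where A': "A' \<subseteq> A b" "card A' = card (Y b)"
    using b obtain_subset_with_card_n by metis
  have "A (\<not> b) \<noteq> {}"
    using ne[of "(\<not> b) = k"] by (auto simp: A_def l_def)
  then have pos: "card (A (\<not> b)) > 0" using finA by auto
  \<comment> \<open>One place in \<open>Y'\<close> is reserved for \<open>z2\<close>, the vertex
    where the connecting edge arrives.\<close>
  have "card (A (\<not> b)) - 1 \<le> card (Y (\<not> b) - {z2})"
    using sum[of b] b z finA by simp
  then obtain Y0 where Y0: "Y0 \<subseteq> Y (\<not> b) - {z2}" "card Y0 = card (A (\<not> b)) - 1"
    using obtain_subset_with_card_n by metis
  define Y' where "Y' = insert z2 Y0"
  have finY0: "finite Y0" using Y0 finA finite_subset by blast
  have Y': "Y' \<subseteq> Y (\<not> b)" "card Y' = card (A (\<not> b))" "z2 \<in> Y'" "finite Y'"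
    using Y0 z pos finY0 by (auto simp: Y'_def card_insert_if)
  have "finite A'" using A' finA finite_subset by blast
  have "\<exists>L. path k L \<and> distinct L \<and> set L = Y b \<union> A' \<and> L \<noteq> [] \<and> hd L = z1 \<and> last L \<in> A'"
    by (rule alternating_path) (use A' AY[of b b] finA \<open>finite A'\<close> z lk in auto)
  then obtain P1 where P1: "path k P1" "distinct P1" "set P1 = Y b \<union> A'" "P1 \<noteq> []" "hd P1 = z1"
    by blast
  have "\<exists>L. path k L \<and> distinct L \<and> set L = Y' \<union> A (\<not> b) \<and> L \<noteq> [] \<and> hd L = z2 \<and> last L \<in> A (\<not> b)"
    by (rule alternating_path) (use Y' AY[of "\<not> b" "\<not> b"] finA lk in auto)
  then obtain P2 where P2: "path k P2" "distinct P2" "set P2 = Y' \<union> A (\<not> b)" "P2 \<noteq> []" "hd P2 = z2"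
    "last P2 \<in> A (\<not> b)" by blast
  have "card (Y (\<not> b) - Y') = card (A b - A')"
    using sum[of b] A' Y' finA b by (simp add: card_Diff_subset finite_subset)
  have "\<exists>Q. path (\<not> k) Q \<and> distinct Q \<and> set Q = (Y (\<not> b) - Y') \<union> (A b - A')
    \<and> (Q \<noteq> [] \<longrightarrow> hd Q \<in> Y (\<not> b))"
  proof (cases "Y (\<not> b) - Y' = {}")
    case True
    then have "card (A b - A') = 0"
      using \<open>card (Y (\<not> b) - Y') = card (A b - A')\<close> by (metis card.empty)
    then have "A b - A' = {}" using finA by auto
    then show ?thesis using True by (intro exI[of _ "[]"]) simp
  next
    case False
    then obtain z where z: "z \<in> Y (\<not> b) - Y'" by auto
    have "\<exists>L. path (\<not> k) L \<and> distinct L \<and> set L = (Y (\<not> b) - Y') \<union> (A b - A') \<and> L \<noteq> [] \<and> hd L = z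
      \<and> last L \<in> A b - A'"
      by (rule alternating_path)
        (use AY[of b "\<not> b"] finA z lnk \<open>card (Y (\<not> b) - Y') = card (A b - A')\<close> in auto)
    then show ?thesis using z by blast
  qed
  then obtain Q where Q: "path (\<not> k) Q" "distinct Q" "set Q = (Y (\<not> b) - Y') \<union> (A b - A')"
    "Q \<noteq> [] \<Longrightarrow> hd Q \<in> Y (\<not> b)" by blast
  have "path k (rev P1 @ P2)"
    using P1 P2 z by (simp add: successively_append_iff last_rev)
  moreover have "set (rev P1 @ P2) \<union> set Q = V"
    unfolding V[of b, symmetric] using P1(3) P2(3) Q(3) A' Y' by auto
  moreover have "Y b \<inter> Y (\<not> b) = {}" "A b \<inter> A (\<not> b) = {}"
    by (auto simp: A_def Y_def)
  then have "distinct (rev P1 @ P2 @ Q)"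
    using P1(2,3) P2(2,3) Q(2,3) A'(1) Y'(1) AY[of b b] AY[of b "\<not> b"] AY[of "\<not> b" b] AY[of "\<not> b" "\<not> b"] by auto
  ultimately have "cover k V (rev P1 @ P2) Q"
    using Q(1) by (simp add: cover_def)
  then show ?thesis
  proof (rule cover_hamiltonian)
    assume "Q \<noteq> []"
    then have "c (last P2) \<noteq> c (hd Q)"
      using Q(4) P2(6) adj[of "last P2" "hd Q"] by (auto simp: A_def Y_def)
    then show "c (hd (rev P1 @ P2)) \<noteq> c (hd Q) \<or> c (last (rev P1 @ P2)) \<noteq> c (hd Q)
      \<or> c (hd (rev P1 @ P2)) \<noteq> c (last Q) \<or> c (last (rev P1 @ P2)) \<noteq> c (last Q)"
      using P2(4) by simp
  qed (use P2 in simp)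
qed

end

section \<open>Structure of a spider that cannot be extended\<close>

text \<open>A maximal balanced set extended by one vertex to \<open>S\<close>. Adding the minority vertex \<open>u\<close> would
  contradict maximality, which makes every arm of a spider on \<open>S\<close> close up to a cycle through the
  centre, so that the centre can be rotated along it.\<close>

locale stuck = two_colouring c E for c :: "'a \<Rightarrow> bool" and E :: "'a \<Rightarrow> 'a \<Rightarrow> bool" +
  fixes S :: "'a set" and u :: 'a
  assumes u: "u \<notin> S"
    and majority: "card {z \<in> S. c z \<noteq> c u} = card {z \<in> S. c z = c u} + 1"
    and no_ham: "\<not> hamiltonian (insert u S)"
begin

text \<open>The surplus of one leaves \<open>ham_count\<close> no room for an end in the minority
  class.\<close>

lemma ends:
  assumes "ham k S x y"
  shows "c x \<noteq> c u" "c y \<noteq> c u"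
proof -
  have "{z \<in> S. c z = (\<not> c u)} = {z \<in> S. c z \<noteq> c u}" "{z \<in> S. c z \<noteq> (\<not> c u)} = {z \<in> S. c z = c u}"
    by auto
  then show "c x \<noteq> c u" "c y \<noteq> c u"
    using ham_count[OF assms, of "\<not> c u"] majority by (auto split: if_splits)
qed

lemma spider_ends:
  assumes "spider k S w R B"
  shows "c (last (w # R)) \<noteq> c u" "c (last (w # B)) \<noteq> c u"
  using ends spider_ham[OF assms] by blast+

lemma centre:
  assumes "spider k S w R B"
  shows "c w = c u"
proof (rule ccontr)
  assume "c w \<noteq> c u"
  from attach[OF assms u this] spider_ends[OF assms] no_ham show False by blast
qed

lemma arms:
  assumes "spider k S w R B"
  shows "R \<noteq> []" "B \<noteq> []" "c (hd R) \<noteq> c u" "c (hd B) \<noteq> c u" "c (last R) \<noteq> c u" "c (last B) \<noteq> c u"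
proof -
  show R: "R \<noteq> []" and B: "B \<noteq> []"
    using spider_ends[OF assms] centre[OF assms] by auto
  then show "c (last R) \<noteq> c u" "c (last B) \<noteq> c u"
    using spider_ends[OF assms] by auto
  show "c (hd R) \<noteq> c u" "c (hd B) \<noteq> c u"
    using assms R B centre[OF assms] by (auto simp: spider_def successively_Cons link_def)
qed

text \<open>With the other colour on this edge, \<open>last R\<close> could serve as centre,
  although it lies in the majority class.\<close>

lemma closing:
  assumes sp: "spider k S w R B"
  shows "link k w (last R)"
proof (rule ccontr)
  assume "\<not> link k w (last R)"
  then have l: "link (\<not> k) (last R) w"
    using link_cases[of w "last R" k] arms[OF sp] centre[OF sp] link_sym by auto
  obtain R' r where R: "R = R' @ [r]" using arms(1)[OF sp] by (metis append_butlast_last_id)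
  have "path k (rev (R' @ [r]))"
    using sp R by (simp only: path_rev) (auto simp: spider_def successively_Cons)
  then have "spider k S r (rev R') (w # B)"
    using sp R l by (auto simp: spider_def simp del: path_flip successively_rev)
  from centre[OF this] show False using arms(5)[OF sp] R by auto
qed

text \<open>By \<open>closing\<close> the arm and the centre form a cycle, which can be opened at
  \<open>a\<close> instead of \<open>w\<close>. The edge from \<open>a\<close> to the other arm has
  the right colour, since otherwise the head of that arm would be a centre in the majority
  class.\<close>

lemma rotate_arm:
  assumes sp: "spider k S w (xs @ a # ys) B" and a: "c a = c u"
  shows "spider k S a (ys @ w # xs) B"
proof -
  have ys: "ys \<noteq> []" using arms(5)[OF sp] a by auto
  obtain b B' where B: "B = b # B'" using arms(2)[OF sp] by (cases B) auto
  have "link k (last ys) w" using closing[OF sp] ys link_sym by auto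
  moreover have "path k (w # xs)" "path k (a # ys)"
    using sp by (auto simp: spider_def successively_append_iff successively_Cons)
  ultimately have pth: "path k (a # ys @ w # xs)"
    using ys by (auto simp: successively_append_iff successively_Cons)
  have "link (\<not> k) a b"
  proof (rule ccontr)
    assume "\<not> link (\<not> k) a b"
    then have "link k b a" using link_cases[of a b k] a arms(4)[OF sp] B link_sym by auto
    then have "spider k S b (a # ys @ w # xs) B'"
      using sp pth B by (auto simp: spider_def successively_Cons)
    from centre[OF this] show False using arms(4)[OF sp] B by auto
  qed
  then show ?thesis using sp pth B by (auto simp: spider_def successively_Cons)
qed

lemma u_hd:
  assumes sp: "spider k S w R B"
  shows "link (\<not> k) u (hd R)"
proof (rule ccontr)
  assume "\<not> link (\<not> k) u (hd R)"
  then have "link k u (hd R)" using link_cases[of u "hd R" k] arms(3)[OF sp] by auto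
  then have "cover k (insert u S) (u # R) (w # B)"
    using sp u by (auto simp: spider_def cover_def successively_Cons)
  then have "hamiltonian (insert u S)"
    by (rule cover_hamiltonian) (use arms[OF sp] in auto)
  then show False using no_ham by blast
qed

text \<open>Rotation to the predecessor of \<open>y\<close> makes \<open>y\<close> the head of its
  arm, where \<open>u_hd\<close> applies.\<close>

lemma u_arm:
  assumes sp: "spider k S w R B" and y: "y \<in> set R" "c y \<noteq> c u"
  shows "link (\<not> k) u y"
proof -
  obtain pre ys where R: "R = pre @ y # ys" using y(1) by (meson split_list)
  show ?thesis
  proof (cases pre rule: rev_cases)
    case Nil
    then show ?thesis using u_hd[OF sp] R by simp
  next
    case (snoc xs a)
    then have "link k a y" using sp R by (auto simp: spider_def successively_append_iff successively_Cons)
    then have a: "c a = c u" using y(2) by (auto simp: link_def)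
    have "spider k S w (xs @ a # (y # ys)) B" using sp R snoc by simp
    from u_hd[OF rotate_arm[OF this a]] show ?thesis by simp
  qed
qed

text \<open>The special case to which \<open>centre_arm\<close> reduces. A wrongly coloured edge
  would put \<open>u\<close>, \<open>y2\<close>, \<open>w\<close>, \<open>B\<close> on one path;
  this forces the colours of two further edges, which extend that path until only \<open>ms\<close>
  remains for colour \<open>k\<close>.\<close>

lemma third_vertex:
  assumes sp: "spider k S w (y1 # a1 # y2 # ys) B"
  shows "\<not> link (\<not> k) w y2"
proof
  assume l: "link (\<not> k) w y2"
  have w: "c w = c u" using centre[OF sp] .
  have lk: "link k w y1" "link k y1 a1" "link k a1 y2" "path k (y2 # ys)"
    using sp by (auto simp: spider_def)
  then have cc: "c y1 \<noteq> c u" "c a1 = c u" "c y2 \<noteq> c u" using w by (auto simp: link_def)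
  have "ys \<noteq> []" using closing[OF sp] l by (auto simp: link_def)
  then obtain a2 zs where ys: "ys = a2 # zs" by (cases ys) auto
  have a2: "c a2 = c u" using lk(4) ys cc by (auto simp: link_def)
  then have "zs \<noteq> []" using arms(5)[OF sp] ys by auto
  then obtain ms r where zs: "zs = ms @ [r]" by (metis append_butlast_last_id)
  have r: "c r \<noteq> c u" using arms(5)[OF sp] ys zs by auto
  have p: "path k (a2 # ms @ [r])" using lk(4) ys zs by auto
  have uy: "link (\<not> k) u y1" "link (\<not> k) u y2"
    using u_arm[OF sp] cc by auto
  have pB: "path (\<not> k) (w # B)" using sp by (auto simp: spider_def)
  have dist: "distinct (u # w # y1 # a1 # y2 # a2 # ms @ [r] @ B)"
    and set: "insert u S = set (u # w # y1 # a1 # y2 # a2 # ms @ [r] @ B)"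
    using sp u ys zs by (auto simp: spider_def)
  have blue: "path (\<not> k) (u # y2 # w # B)"
    using pB l uy link_sym by auto
  have "link (\<not> k) a1 r"
  proof (rule ccontr)
    assume "\<not> link (\<not> k) a1 r"
    then have "link k a1 r" using link_cases[of a1 r k] cc r by auto
    then have "path k ([y1, a1] @ rev (a2 # ms @ [r]))"
      using p lk path_rev[of k "a2 # ms @ [r]"]
      by (simp add: successively_append_iff del: path_flip successively_rev)
    then have "cover k (insert u S) ([y1, a1] @ rev (a2 # ms @ [r])) (u # y2 # w # B)"
      using blue dist set by (auto simp: cover_def simp del: path_flip successively_rev)
    then have "hamiltonian (insert u S)"
      by (rule cover_hamiltonian) (use cc in auto)
    then show False using no_ham by blast
  qed
  have "link (\<not> k) a2 y1"
  proof (rule ccontr)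
    assume "\<not> link (\<not> k) a2 y1"
    then have "link k y1 a2" using link_cases[of a2 y1 k] cc a2 link_sym by auto
    then have "path k (a1 # y1 # a2 # ms @ [r])"
      using p lk link_sym by auto
    then have "cover k (insert u S) (a1 # y1 # a2 # ms @ [r]) (u # y2 # w # B)"
      using blue dist set by (auto simp: cover_def)
    then have "hamiltonian (insert u S)"
      by (rule cover_hamiltonian) (use r in auto)
    then show False using no_ham by blast
  qed
  have "spider k S w ([y1] @ a1 # (y2 # ys)) B" using sp by simp
  from closing[OF spider_swap[OF rotate_arm[OF this cc(2)]]] have "link (\<not> k) (last B) a1"
    using link_sym by blast
  then have "path (\<not> k) ((w # B) @ [a1, r])"
    using pB \<open>link (\<not> k) a1 r\<close> arms(2)[OF sp] by (subst successively_append_iff) auto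
  then have "path (\<not> k) (a2 # y1 # u # y2 # w # B @ [a1, r])"
    using \<open>link (\<not> k) a2 y1\<close> uy l link_sym by auto
  moreover have "path k ms" using p by (auto simp: successively_Cons successively_append_iff)
  ultimately have "cover k (insert u S) ms (a2 # y1 # u # y2 # w # B @ [a1, r])"
    using dist set by (auto simp: cover_def)
  then have "hamiltonian (insert u S)"
  proof (rule cover_hamiltonian)
    assume "ms \<noteq> []"
    then have "c (hd ms) \<noteq> c a2"
      using p by (cases ms) (auto simp: link_def)
    then show "c (hd ms) \<noteq> c (hd (a2 # y1 # u # y2 # w # B @ [a1, r]))
      \<or> c (last ms) \<noteq> c (hd (a2 # y1 # u # y2 # w # B @ [a1, r]))
      \<or> c (hd ms) \<noteq> c (last (a2 # y1 # u # y2 # w # B @ [a1, r]))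
      \<or> c (last ms) \<noteq> c (last (a2 # y1 # u # y2 # w # B @ [a1, r]))"
      by simp
  qed simp
  then show False using no_ham by blast
qed

text \<open>If the edge to \<open>y\<close> had the wrong colour, so would the edge between
  \<open>a\<close> and \<open>x1\<close>, by rearrangements as in \<open>third_vertex\<close>.
  Rotating the centre to \<open>a\<close> brings \<open>x1\<close> to third place, which
  \<open>third_vertex\<close> forbids.\<close>

lemma centre_arm:
  assumes sp: "spider k S w R B" and y: "y \<in> set R" "c y \<noteq> c u"
  shows "link k w y"
proof (rule ccontr)
  assume "\<not> link k w y"
  then have l: "link (\<not> k) w y" using link_cases[of w y k] y(2) centre[OF sp] by auto
  have w: "c w = c u" using centre[OF sp] .
  obtain xs ys where R: "R = xs @ y # ys" using y(1) by (meson split_list)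
  have pR: "path k (w # xs @ y # ys)" and pB: "path (\<not> k) (w # B)"
    using sp R by (auto simp: spider_def)
  have "xs \<noteq> []" using pR l by (auto simp: link_def)
  then obtain xs' a1 where xs: "xs = xs' @ [a1]" by (metis append_butlast_last_id)
  have "link k a1 y" using pR xs by (auto simp: successively_append_iff successively_Cons)
  then have a1: "c a1 = c u" using y(2) by (auto simp: link_def)
  then have "xs' \<noteq> []" using arms(3)[OF sp] R xs by auto
  then obtain x1 xs'' where xs': "xs' = x1 # xs''" by (cases xs') auto
  have x1: "c x1 \<noteq> c u" using arms(3)[OF sp] R xs xs' by auto
  have "ys \<noteq> []" using closing[OF sp] l R by (auto simp: link_def)
  then obtain ys' r where ys: "ys = ys' @ [r]" by (metis append_butlast_last_id)
  have r: "c r \<noteq> c u" using arms(5)[OF sp] R ys by auto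
  have "ys' \<noteq> []"
  proof
    assume "ys' = []"
    then have "link k y r" using pR ys by (auto simp: successively_append_iff successively_Cons)
    then show False using y(2) r by (auto simp: link_def)
  qed
  then obtain zs a where ys': "ys' = zs @ [a]" by (metis append_butlast_last_id)
  have "link k a r" using pR ys ys' by (auto simp: successively_append_iff successively_Cons)
  then have a: "c a = c u" using r by (auto simp: link_def)
  have uy: "link (\<not> k) u y" using u_arm[OF sp y] .
  have pxs: "path k xs" "path k ys" "path k xs'" "path k ys'" "link k (last xs') a1"
    using pR xs ys \<open>xs' \<noteq> []\<close> by (auto simp: successively_append_iff successively_Cons)
  have dist: "distinct (u # w # xs' @ [a1, y] @ ys' @ [r] @ B)"
    and set: "insert u S = set (u # w # xs' @ [a1, y] @ ys' @ [r] @ B)"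
    using sp u R xs ys by (auto simp: spider_def)
  have blue: "path (\<not> k) (u # y # w # B)"
    using pB l uy link_sym by auto
  have a1r: "link (\<not> k) a1 r"
  proof (rule ccontr)
    assume "\<not> link (\<not> k) a1 r"
    then have "link k a1 r" using link_cases[of a1 r k] a1 r by auto
    then have "path k (xs @ rev ys)"
      using pxs xs ys path_rev[of k ys]
      by (simp add: successively_append_iff hd_rev del: path_flip successively_rev)
    then have "cover k (insert u S) (xs @ rev ys) (u # y # w # B)"
      using blue dist set xs ys by (auto simp: cover_def simp del: path_flip successively_rev)
    then have "hamiltonian (insert u S)"
      by (rule cover_hamiltonian) (use x1 xs xs' in auto)
    then show False using no_ham by blast
  qed
  have "spider k S w (xs' @ a1 # (y # ys)) B" using sp R xs by simp
  from closing[OF spider_swap[OF rotate_arm[OF this a1]]] have "link (\<not> k) (last B) a1"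
    using link_sym by blast
  then have "path (\<not> k) ((w # B) @ [a1, r])"
    using pB a1r arms(2)[OF sp] by (subst successively_append_iff) auto
  then have blue2: "path (\<not> k) (u # y # w # B @ [a1, r])"
    using uy l link_sym by auto
  have "link (\<not> k) a x1"
  proof (rule ccontr)
    assume "\<not> link (\<not> k) a x1"
    then have "link k x1 a" using link_cases[of a x1 k] a x1 link_sym by auto
    then have "path k (rev xs' @ rev ys')"
      using pxs xs' ys' path_rev[of k ys'] path_rev[of k xs']
      by (simp add: successively_append_iff hd_rev last_rev del: path_flip successively_rev)
    then have "cover k (insert u S) (rev xs' @ rev ys') (u # y # w # B @ [a1, r])"
      using blue2 dist set by (auto simp: cover_def simp del: path_flip successively_rev)
    then have "hamiltonian (insert u S)"
      by (rule cover_hamiltonian) (use pxs(5) a1 \<open>xs' \<noteq> []\<close> in \<open>auto simp: hd_append hd_rev link_def\<close>)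
    then show False using no_ham by blast
  qed
  moreover have "spider k S w ((xs @ y # zs) @ a # [r]) B" using sp R ys ys' by simp
  from rotate_arm[OF this a] have "spider k S a (r # w # x1 # (xs'' @ [a1] @ y # zs)) B"
    using xs xs' by simp
  ultimately show False using third_vertex by blast
qed

text \<open>Rotating the arm through \<open>a\<close> only exchanges \<open>a\<close> with the old
  centre, and both are minority vertices.\<close>

lemma recentre:
  assumes sp: "spider k S w R B" and a: "a \<in> S" "c a = c u"
  shows "\<exists>R' B'. spider k S a R' B' \<and> (\<forall>y. c y \<noteq> c u \<longrightarrow> (y \<in> set R' \<longleftrightarrow> y \<in> set R) \<and> (y \<in> set B' \<longleftrightarrow> y \<in> set B))"
proof -
  consider "a = w" | "a \<in> set R" | "a \<in> set B" using sp a(1) by (auto simp: spider_def)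
  then show ?thesis
  proof cases
    case 1
    then show ?thesis using sp by blast
  next
    case 2
    then obtain xs ys where R: "R = xs @ a # ys" by (meson split_list)
    then show ?thesis
      using rotate_arm[of k w xs a ys B] sp a(2) centre[OF sp]
      by (intro exI[of _ "ys @ w # xs"] exI[of _ B]) auto
  next
    case 3
    then obtain xs ys where B: "B = xs @ a # ys" by (meson split_list)
    then have "spider (\<not> k) S a (ys @ w # xs) R"
      using rotate_arm[of "\<not> k" w xs a ys R] spider_swap[OF sp] a(2) by blast
    from spider_swap[OF this] have "spider k S a R (ys @ w # xs)" by simp
    then show ?thesis
      using B a(2) centre[OF sp]
      by (intro exI[of _ R] exI[of _ "ys @ w # xs"]) auto
  qed
qed

lemma inner_colour:
  assumes sp: "spider k S w R B" and a: "a \<in> S" "c a = c u" and y: "c y \<noteq> c u"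
  shows "y \<in> set R \<Longrightarrow> link k a y" "y \<in> set B \<Longrightarrow> link (\<not> k) a y"
proof -
  obtain R' B' where "spider k S a R' B'" "y \<in> set R' \<longleftrightarrow> y \<in> set R" "y \<in> set B' \<longleftrightarrow> y \<in> set B"
    using recentre[OF sp a] y by blast
  then show "y \<in> set R \<Longrightarrow> link k a y" "y \<in> set B \<Longrightarrow> link (\<not> k) a y"
    using centre_arm[of k a R' B' y] centre_arm[OF spider_swap, of k a R' B' y] y by auto
qed

text \<open>If both edges had the same colour, then after recentring at \<open>a\<close> the arm of
  this colour could be prolonged by \<open>v\<close> and \<open>u\<close>. Dropping its last vertex,
  which is in the majority, gives a spider excluded by \<open>max\<close>.\<close>

lemma outer_colour:
  assumes sp: "spider k S w R B" and v: "v \<notin> S" "c v \<noteq> c u"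
    and max: "\<And>y. y \<in> S \<Longrightarrow> c y \<noteq> c u \<Longrightarrow> \<not> hamiltonian (insert u (insert v (S - {y})))"
    and a: "a \<in> S" "c a = c u"
  shows "E v a \<noteq> E v u"
proof
  assume eq: "E v a = E v u"
  define j where "j = E v u"
  obtain R1 B1 where sp1: "spider k S a R1 B1" using recentre[OF sp a] by blast
  have "j = k \<or> j = (\<not> k)" by auto
  then obtain R B where sp: "spider j S a R B" using sp1 spider_swap[OF sp1] by auto
  obtain R' r where R: "R = R' @ [r]" using arms(1)[OF sp] by (metis append_butlast_last_id)
  have r: "r \<in> S" "c r \<noteq> c u" using sp R arms(5)[OF sp] by (auto simp: spider_def)
  have "path j (a # R')"
    using sp R by (auto simp: spider_def successively_append_iff successively_Cons)
  moreover have "link j u v" "link j v a"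
    using v a eq E_sym by (auto simp: link_def j_def)
  ultimately have "path j (u # v # a # R')" by simp
  moreover have "path (\<not> j) B" using sp by (auto simp: spider_def successively_Cons)
  moreover have "u \<noteq> v" using v by auto
  ultimately have "cover j (insert u (insert v (S - {r}))) (u # v # a # R') B"
    using sp R u v by (auto simp: spider_def cover_def)
  then have "hamiltonian (insert u (insert v (S - {r})))"
    by (rule cover_hamiltonian) (use arms[OF sp] in auto)
  then show False using max r by blast
qed

end

section \<open>Maximal balanced sets in the bipartite graph\<close>

locale bipartite = two_colouring c E for c :: "'a \<Rightarrow> bool" and E :: "'a \<Rightarrow> 'a \<Rightarrow> bool"
begin

definition balanced :: "'a set \<Rightarrow> bool" where
  "balanced T \<longleftrightarrow> card {z \<in> T. c z} = card {z \<in> T. \<not> c z}"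

lemma balanced_alt: "balanced T \<longleftrightarrow> card {z \<in> T. c z = s} = card {z \<in> T. c z \<noteq> s}"
  by (cases s) (auto simp: balanced_def)

text \<open>On a balanced set \<open>ham_count\<close> forbids both ends on the side of
  \<open>v\<close>, so \<open>attach\<close> applies.\<close>

lemma balanced_extend:
  assumes bal: "balanced T" and sp: "spider k T w R B" and v: "v \<notin> T" "c v \<noteq> c w"
  shows "hamiltonian (insert v T)"
proof (rule attach[OF sp v(1)])
  show "c w \<noteq> c v" using v by auto
  show "\<not> (c (last (w # R)) = c v \<and> c (last (w # B)) = c v)"
  proof
    assume "c (last (w # R)) = c v \<and> c (last (w # B)) = c v"
    then have "c (last (w # R)) \<noteq> (\<not> c v)" "c (last (w # B)) \<noteq> (\<not> c v)" by auto
    then show False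
      using ham_count[OF spider_ham[OF sp], of "\<not> c v"] bal balanced_alt[of T "\<not> c v"]
      by (simp del: last.simps)
  qed
qed

text \<open>A largest balanced set \<open>T\<close> carrying a spider is either \<open>V\<close> or
  extends by one vertex to a set \<open>S\<close> that is stuck for every missing minority vertex;
  the colours forced there are exactly those of a split.\<close>

lemma split_or_hamiltonian:
  assumes fin: "finite V" and bal: "balanced V" and ne: "V \<noteq> {}"
  shows "hamiltonian V \<or> (\<exists>g :: 'a \<Rightarrow> bool.
    (\<forall>x \<in> V. \<forall>y \<in> V. c x \<noteq> c y \<longrightarrow> E x y = (g x = g y)) \<and> (\<forall>s b. \<exists>x \<in> V. c x = s \<and> g x = b))"
proof -
  let ?P = "\<lambda>T. T \<subseteq> V \<and> balanced T \<and> hamiltonian T"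
  have sides: "\<exists>x \<in> V. c x = s" for s
  proof (rule ccontr)
    assume "\<not> ?thesis"
    then have "{z \<in> V. c z = s} = {}" "{z \<in> V. c z \<noteq> s} = V" by auto
    then show False using bal ne fin balanced_alt[of V s] by (metis card.empty card_0_eq)
  qed
  obtain p q where pq: "p \<in> V" "q \<in> V" "c p" "\<not> c q" using sides by metis
  have "cover True {p, q} [p] [q]" using pq by (auto simp: cover_def)
  then have "hamiltonian {p, q}" by (rule cover_hamiltonian) (use pq in auto)
  moreover have "{z \<in> {p, q}. c z} = {p}" "{z \<in> {p, q}. \<not> c z} = {q}" using pq by auto
  then have "balanced {p, q}" by (simp add: balanced_def)
  ultimately have "?P {p, q}" using pq by auto
  moreover have "\<forall>T. ?P T \<longrightarrow> card T < Suc (card V)" using card_mono[OF fin] by (auto simp: less_Suc_eq_le)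
  ultimately have "\<exists>T. ?P T \<and> (\<forall>T'. ?P T' \<longrightarrow> card T' \<le> card T)"
    by (rule ex_has_greatest_nat)
  then obtain T where T: "?P T" and max: "\<And>T'. ?P T' \<Longrightarrow> card T' \<le> card T" by metis
  show ?thesis
  proof (cases "T = V")
    case True
    then show ?thesis using T by blast
  next
    case False
    have finT: "finite T" using T fin finite_subset by blast
    have outside: "\<exists>x \<in> V - T. c x = s" for s
    proof (rule ccontr)
      assume "\<not> ?thesis"
      then have "{z \<in> V. c z = s} = {z \<in> T. c z = s}" using T by auto
      then have "card {z \<in> V. c z \<noteq> s} = card {z \<in> T. c z \<noteq> s}"
        using T bal balanced_alt[of V s] balanced_alt[of T s] by simp
      then have "{z \<in> T. c z \<noteq> s} = {z \<in> V. c z \<noteq> s}"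
        using T fin by (intro card_subset_eq) auto
      then have "T = V" using T \<open>{z \<in> V. c z = s} = {z \<in> T. c z = s}\<close> by blast
      then show False using False by blast
    qed
    obtain k w R B where "spider k T w R B" using T by (auto simp: hamiltonian_def ham_def)
    \<comment> \<open>\<open>a\<close> lies opposite the centre, as \<open>balanced_extend\<close>
      requires, so the side \<open>t\<close> of the centre is the minority of
      \<open>S\<close>.\<close>
    obtain a where a: "a \<in> V - T" "c a = (\<not> c w)" using outside by metis
    define S where "S = insert a T"
    obtain u where u0: "u \<in> V - T" "c u = c w" using outside by metis
    have "hamiltonian S"
      unfolding S_def by (rule balanced_extend[OF _ \<open>spider k T w R B\<close>]) (use T a in auto)
    then obtain k w0 R B where sp: "spider k S w0 R B" by (auto simp: hamiltonian_def ham_def)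
    define t where "t = c w"
    have finS: "finite S" using finT S_def by simp
    have S: "S \<subseteq> V" using T a S_def by auto
    have sT: "{z \<in> S. c z = t} = {z \<in> T. c z = t}" "{z \<in> S. c z \<noteq> t} = insert a {z \<in> T. c z \<noteq> t}"
      using a by (auto simp: S_def t_def)
    have maj: "card {z \<in> S. c z \<noteq> t} = card {z \<in> S. c z = t} + 1"
      unfolding sT using a finT T balanced_alt[of T t] by simp
    have big: "\<not> hamiltonian T'" if "T' \<subseteq> V" "balanced T'" "card T' > card T" for T'
    proof
      assume "hamiltonian T'"
      then have "card T' \<le> card T" using that by (intro max) simp
      then show False using that by simp
    qed
    have st: "stuck c E S u" if u: "u \<in> V - S" "c u = t" for u
    proof
      show "u \<notin> S" using u by auto
      show "card {z \<in> S. c z \<noteq> c u} = card {z \<in> S. c z = c u} + 1" using maj u by simp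
      have "{z \<in> insert u S. c z = t} = insert u {z \<in> S. c z = t}" "{z \<in> insert u S. c z \<noteq> t} = {z \<in> S. c z \<noteq> t}"
        using u by auto
      then have "balanced (insert u S)"
        using maj u finS balanced_alt[of "insert u S" t] by simp
      then show "\<not> hamiltonian (insert u S)"
        using u S finT a by (intro big) (auto simp: S_def)
    qed
    have w0: "w0 \<in> S" using sp by (auto simp: spider_def)
    have u: "u \<in> V - S" "c u = t" using u0 a by (auto simp: S_def t_def)
    have cw0: "c w0 = t" using stuck.centre[OF st[OF u] sp] u by simp
    note arms = stuck.arms[OF st[OF u] sp]
    \<comment> \<open>Each majority vertex is labelled by the colour of its edge to
      \<open>w0\<close>. A minority vertex inside \<open>S\<close> sees it in that same colour, one
      outside \<open>S\<close> in the opposite colour.\<close>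
    define g where "g = (\<lambda>x. if c x = t then x \<in> S else E w0 x)"
    have key: "E x y = (g x = g y)" if x: "x \<in> V" "c x = t" and y: "y \<in> V" "c y \<noteq> t" for x y
    proof (cases "y \<in> S")
      case True
      then have yRB: "y \<in> set R \<or> y \<in> set B" using sp y cw0 by (auto simp: spider_def)
      note inner = stuck.inner_colour[OF st[OF u] sp, of _ y]
      show ?thesis
      proof (cases "x \<in> S")
        case True
        then show ?thesis
          using inner[of x] inner[of w0] x y u w0 cw0 yRB by (auto simp: g_def link_def)
      next
        case False
        then have st': "stuck c E S x" using st x by auto
        show ?thesis
          using stuck.u_arm[OF st' sp, of y] stuck.u_arm[OF st' two_colouring.spider_swap[OF _ sp], of y]
            inner[of w0] x y u w0 cw0 yRB False two_colouring_axioms by (auto simp: g_def link_def)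
      qed
    next
      case False
      have diff: "E y z \<noteq> E y u'" if "z \<in> S" "c z = t" "u' \<in> V - S" "c u' = t" for z u'
      proof (rule stuck.outer_colour[OF st[OF that(3,4)] sp False])
        show "c y \<noteq> c u'" "z \<in> S" "c z = c u'" using y that by auto
        fix y' assume y': "y' \<in> S" "c y' \<noteq> c u'"
        \<comment> \<open>Exchanging \<open>y'\<close> for \<open>y\<close> and adding
          \<open>u'\<close> gives a balanced set larger than \<open>T\<close>, so it carries no
          spider.\<close>
        let ?T = "insert u' (insert y (S - {y'}))"
        have "{z \<in> ?T. c z = t} = insert u' {z \<in> S. c z = t}"
          "{z \<in> ?T. c z \<noteq> t} = insert y ({z \<in> S. c z \<noteq> t} - {y'})"
          using that y y' by auto
        moreover have "card (insert y ({z \<in> S. c z \<noteq> t} - {y'})) = card {z \<in> S. c z \<noteq> t}"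
          using y' that False finS maj by simp
        ultimately have "balanced ?T"
          using maj that finS balanced_alt[of ?T t] by simp
        moreover have "card ?T = card S + 1"
        proof -
          have "card (insert y (S - {y'})) = Suc (card (S - {y'}))" using False finS by simp
          also have "\<dots> = card S" using card_Suc_Diff1[OF finS y'(1)] .
          finally have "card (insert y (S - {y'})) = card S" .
          moreover have "u' \<notin> insert y (S - {y'})" using that y by auto
          ultimately show ?thesis using finS by simp
        qed
        then have "card ?T > card T" using a finT by (simp add: S_def)
        ultimately show "\<not> hamiltonian ?T"
          using S that y by (intro big) auto
      qed
      show ?thesis
      proof (cases "x \<in> S")
        case True
        then show ?thesis
          using diff[of x u] diff[of w0 u] x y u w0 cw0 E_sym[of x y] E_sym[of w0 y] by (auto simp: g_def)
      next
        case False
        then show ?thesis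
          using diff[of w0 x] x y w0 cw0 E_sym[of x y] E_sym[of w0 y] by (auto simp: g_def)
      qed
    qed
    have "E x y = (g x = g y)" if "x \<in> V" "y \<in> V" "c x \<noteq> c y" for x y
      using key[of x y] key[of y x] that E_sym[of x y] by (cases "c x = t") auto
    moreover have "\<exists>x \<in> V. c x = s \<and> g x = b" for s b
    proof (cases "s = t")
      case True
      then show ?thesis using u w0 cw0 S by (cases b) (auto simp: g_def)
    next
      case False
      have "hd R \<in> V" "c (hd R) \<noteq> t" "link k w0 (hd R)" "hd B \<in> V" "c (hd B) \<noteq> t" "link (\<not> k) w0 (hd B)"
        using arms sp S u by (auto simp: spider_def successively_Cons)
      then have "\<exists>x \<in> V. c x \<noteq> t \<and> E w0 x = b"
        by (cases "b = k") (auto simp: link_def)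
      then show ?thesis using False by (auto simp: g_def)
    qed
    ultimately show ?thesis by (intro disjI2 exI[of _ g]) simp
  qed
qed

end

section \<open>The remaining slacks and the tripartite case\<close>

context two_colouring
begin

text \<open>Treating all vertices outside class \<open>t\<close> as one side gives a balanced
  bipartite graph. A spider there is a spider here; a split is resolved by an edge outside class
  \<open>t\<close> between its halves.\<close>

lemma tight:
  assumes fin: "finite V" and half: "2 * card {z \<in> V. c z = t} = card V"
    and y: "y \<in> V" "y' \<in> V" "c y \<noteq> t" "c y' \<noteq> t" "c y \<noteq> c y'"
  shows "hamiltonian V"
proof -
  interpret b: bipartite "\<lambda>z. c z = t" E
    by unfold_locales (rule E_sym)
  have lift: "path k xs" if "b.path k xs" for k xs
    using that by (rule successively_mono) (auto simp: b.link_def link_def)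
  have "{z \<in> V. c z = t} \<union> {z \<in> V. c z \<noteq> t} = V" "{z \<in> V. c z = t} \<inter> {z \<in> V. c z \<noteq> t} = {}"
    by auto
  then have "card {z \<in> V. c z = t} + card {z \<in> V. c z \<noteq> t} = card V"
    using fin card_Un_disjoint[of "{z \<in> V. c z = t}" "{z \<in> V. c z \<noteq> t}"] by simp
  then have bal: "card {z \<in> V. c z = t} = card {z \<in> V. c z \<noteq> t}"
    using half by simp
  then have "b.balanced V" by (simp add: b.balanced_def)
  moreover have "V \<noteq> {}" using y by auto
  ultimately have "b.hamiltonian V \<or> (\<exists>g :: 'a \<Rightarrow> bool.
      (\<forall>x \<in> V. \<forall>y \<in> V. (c x = t) \<noteq> (c y = t) \<longrightarrow> E x y = (g x = g y)) \<and>
      (\<forall>s b. \<exists>x \<in> V. (c x = t) = s \<and> g x = b))"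
    by (rule b.split_or_hamiltonian[OF fin])
  then show ?thesis
  proof (elim disjE exE conjE)
    assume "b.hamiltonian V"
    then obtain k w R B where "b.spider k V w R B" by (auto simp: b.hamiltonian_def b.ham_def)
    then have "spider k V w R B"
      unfolding b.spider_def spider_def using lift by blast
    then show ?thesis using spider_ham unfolding hamiltonian_def by blast
  next
    fix g :: "'a \<Rightarrow> bool"
    assume g: "\<forall>x \<in> V. \<forall>y \<in> V. (c x = t) \<noteq> (c y = t) \<longrightarrow> E x y = (g x = g y)"
      and all: "\<forall>s b. \<exists>x \<in> V. (c x = t) = s \<and> g x = b"
    \<comment> \<open>If \<open>y\<close> and \<open>y'\<close> have equal labels, a vertex
      \<open>z\<close> with the other label is adjacent to one of them, as their classes
      differ.\<close>
    obtain y1 y2 where y12: "y1 \<in> V" "y2 \<in> V" "c y1 \<noteq> t" "c y2 \<noteq> t" "g y1 \<noteq> g y2" "c y1 \<noteq> c y2"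
    proof (cases "g y = g y'")
      case True
      obtain z where "z \<in> V" "c z \<noteq> t" "g z = (\<not> g y)" using all[rule_format, of False "\<not> g y"] by auto
      then show thesis using that[of y z] that[of y' z] y True by (cases "c z = c y") auto
    next
      case False
      then show thesis using that y by blast
    qed
    show ?thesis
    proof (rule split_hamiltonian[OF fin _ bal _ _ y12])
      show "E x y = (g x = g y)" if "x \<in> V" "y \<in> V" "(c x = t) \<noteq> (c y = t)" for x y
        using g that by blast
      show "\<exists>x \<in> V. c x = t \<and> g x = b" for b
        using all[rule_format, of True b] by auto
    qed auto
  qed
qed

text \<open>Removing a vertex \<open>u\<close> outside the class of \<open>a\<close> makes that
  class exactly half. Every spider on the rest then has an end in the class of \<open>a\<close>, so
  \<open>absorb\<close> can take \<open>u\<close> back.\<close>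

lemma slack_one:
  assumes fin: "finite V" and three: "c ` V = {c a, c b, c d}" "c a \<noteq> c b" "c a \<noteq> c d" "c b \<noteq> c d"
    and V: "a \<in> V" "b \<in> V" "d \<in> V"
    and one: "2 * card (class_of V a) + 1 = card V"
    and fair: "\<And>x. x \<in> V \<Longrightarrow> 2 * card (class_of V x) \<le> card V"
  shows "hamiltonian V"
proof -
  have fc: "finite (class_of V x)" for x using fin by (auto simp: class_of_def)
  note n = card_three_classes[OF fin three]
  have pos: "card (class_of V x) \<ge> 1" if "x \<in> V" for x
  proof -
    have "x \<in> class_of V x" using that by (auto simp: class_of_def)
    then show ?thesis using fc by (metis Suc_leI One_nat_def card_gt_0_iff empty_iff)
  qed
  have remove: "card (V - {u}) = 2 * card {z \<in> V - {u}. c z = c a}" if "u \<in> V" "c u \<noteq> c a" for u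
  proof -
    have "{z \<in> V - {u}. c z = c a} = class_of V a" using that by (auto simp: class_of_def)
    then show ?thesis using one that fin by simp
  qed
  have step: "hamiltonian (V - {u})"
    if u: "u \<in> V" "c u \<noteq> c a" "card (class_of V u) \<ge> 2" and v: "v \<in> V" "c v \<noteq> c a" "c v \<noteq> c u" for u v
  proof -
    have "card (class_of V u - {u}) \<noteq> 0" using u fc by (simp add: class_of_def)
    then have "class_of V u - {u} \<noteq> {}" by (metis card.empty)
    then obtain u' where "u' \<in> V - {u}" "c u' = c u" by (auto simp: class_of_def)
    then show ?thesis
      using tight[of "V - {u}" "c a" u' v] remove[OF u(1,2)] fin u v by auto
  qed
  have "\<exists>u \<in> V. c u \<noteq> c a \<and> hamiltonian (V - {u})"
  proof (cases "card (class_of V b) \<ge> 2 \<or> card (class_of V d) \<ge> 2")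
    case True
    then show ?thesis using step[of b d] step[of d b] V three by metis
  next
    \<comment> \<open>If no class other than that of \<open>a\<close> survives the removal of a
      vertex, the graph is a triangle and a single edge remains.\<close>
    case False
    then have "card V = 3" using n one pos[OF V(2)] pos[OF V(3)] by auto
    moreover have "a \<noteq> b" "a \<noteq> d" "b \<noteq> d" using three(2-4) by auto
    then have "card {a, b, d} = 3" by simp
    ultimately have "V = {a, b, d}" using V fin by (metis card_subset_eq empty_subsetI insert_subset)
    then have "V - {b} = {a, d}" using three by auto
    moreover have "cover True {a, d} [a] [d]" using three by (auto simp: cover_def)
    then have "hamiltonian {a, d}" by (rule cover_hamiltonian) (use three in auto)
    ultimately show ?thesis using V three by metis
  qed
  then obtain u k x y where u: "u \<in> V" "c u \<noteq> c a" and h: "ham k (V - {u}) x y"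
    by (auto simp: hamiltonian_def)
  have "{z \<in> V - {u}. c z = c a} \<union> {z \<in> V - {u}. c z \<noteq> c a} = V - {u}"
    "{z \<in> V - {u}. c z = c a} \<inter> {z \<in> V - {u}. c z \<noteq> c a} = {}" by auto
  then have "card {z \<in> V - {u}. c z = c a} + card {z \<in> V - {u}. c z \<noteq> c a} = card (V - {u})"
    using fin card_Un_disjoint[of "{z \<in> V - {u}. c z = c a}" "{z \<in> V - {u}. c z \<noteq> c a}"] by simp
  then have "card {z \<in> V - {u}. c z = c a} = card {z \<in> V - {u}. c z \<noteq> c a}"
    using remove[OF u] by simp
  then have "\<not> (c x = c u \<and> c y = c u)"
    using ham_count[OF h, of "c a"] u by auto
  moreover have "insert u (V - {u}) = V" using u by auto
  \<comment> \<open>The inequality is strict because \<open>card V\<close> is odd.\<close>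
  moreover have "2 * card (class_of V u) < card V" using fair[OF u(1)] one by presburger
  ultimately show ?thesis using absorb[OF h, of u] by (simp add: class_of_def)
qed

lemma fair_tripartite_hamiltonian:
  assumes "finite V" "card (c ` V) = 3" "\<And>x. x \<in> V \<Longrightarrow> 2 * card (class_of V x) \<le> card V"
  shows "hamiltonian V"
  using assms
proof (induction V rule: finite_psubset_induct)
  case (psubset V)
  obtain a b d where abd: "a \<in> V" "b \<in> V" "d \<in> V" "c ` V = {c a, c b, c d}"
    "c a \<noteq> c b" "c a \<noteq> c d" "c b \<noteq> c d"
    using three_representatives[OF psubset.prems(1)] .
  have perm: "\<exists>p q. p \<in> V \<and> q \<in> V \<and> c ` V = {c x, c p, c q} \<and> c x \<noteq> c p \<and> c x \<noteq> c q \<and> c p \<noteq> c q"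
    if "x \<in> V" for x
  proof -
    have "c x \<in> {c a, c b, c d}" using that abd(4) by blast
    then consider "c x = c a" | "c x = c b" | "c x = c d" by blast
    then show ?thesis
    proof cases
      case 1
      then show ?thesis using abd by (intro exI[of _ b] exI[of _ d]) auto
    next
      case 2
      then show ?thesis using abd by (intro exI[of _ a] exI[of _ d]) auto
    next
      case 3
      then show ?thesis using abd by (intro exI[of _ a] exI[of _ b]) auto
    qed
  qed
  consider x where "x \<in> V" "2 * card (class_of V x) = card V"
    | x where "x \<in> V" "2 * card (class_of V x) + 1 = card V"
    | "\<And>x. x \<in> V \<Longrightarrow> 2 * card (class_of V x) + 2 \<le> card V"
  proof (cases "\<exists>x \<in> V. card V < 2 * card (class_of V x) + 2")
    case True
    then obtain x where "x \<in> V" "card V < 2 * card (class_of V x) + 2" by blast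
    moreover from this have "2 * card (class_of V x) = card V \<or> 2 * card (class_of V x) + 1 = card V"
      using psubset.prems(2)[of x] by linarith
    ultimately show thesis using that by blast
  next
    case False
    then show thesis using that(3) by (meson not_le)
  qed
  then show ?case
  proof cases
    case (1 x)
    then show ?thesis
      using perm[OF 1(1)] tight[OF psubset.hyps, of "c x"] by (metis class_of_def)
  next
    case (2 x)
    then show ?thesis
      using perm[OF 2(1)] slack_one[OF psubset.hyps] psubset.prems(2) by metis
  next
    case 3
    show ?thesis
      by (rule slack_two[OF psubset.hyps psubset.prems(1) 3]) (use psubset.IH in auto)
  qed
qed

end

section \<open>Merging classes and returning to the given partition\<close>

lemma mono_path_mono:
  assumes "mono_path adj col k p" "\<And>u v. adj u v \<Longrightarrow> adj' u v"
  shows "mono_path adj' col k p"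
  using assms by (auto simp: mono_path_def)

text \<open>Merging deletes the edges between \<open>X\<close> and \<open>Y\<close> and creates
  none.\<close>

lemma cmp_adj_merge:
  assumes "X \<in> P" "Y \<in> P" "cmp_adj (insert (X \<union> Y) (P - {X, Y})) u v"
  shows "cmp_adj P u v"
proof -
  let ?Q = "insert (X \<union> Y) (P - {X, Y})"
  have down: "\<exists>Z \<in> P. x \<in> Z" if "\<exists>Z \<in> ?Q. x \<in> Z" for x
    using that assms(1,2) by auto
  have up: "\<exists>Z' \<in> ?Q. Z \<subseteq> Z'" if "Z \<in> P" for Z
    using that by (cases "Z = X \<or> Z = Y") auto
  have "\<not> (\<exists>Z \<in> P. u \<in> Z \<and> v \<in> Z)"
  proof
    assume "\<exists>Z \<in> P. u \<in> Z \<and> v \<in> Z"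
    then obtain Z where Z: "Z \<in> P" "u \<in> Z" "v \<in> Z" by blast
    then obtain Z' where "Z' \<in> ?Q" "Z \<subseteq> Z'" using up by blast
    then show False using Z assms(3) unfolding cmp_adj_def by blast
  qed
  moreover have "\<exists>Z \<in> P. u \<in> Z" "\<exists>Z \<in> P. v \<in> Z"
    by (rule down; use assms(3) in \<open>simp only: cmp_adj_def\<close>)+
  ultimately show ?thesis unfolding cmp_adj_def by blast
qed

text \<open>A smallest and a second smallest class are compared, one each, with two further
  classes.\<close>

lemma small_pair:
  assumes fin: "finite V" and part: "partition_on V P" and four: "card P \<ge> 4"
  shows "\<exists>X \<in> P. \<exists>Y \<in> P. X \<noteq> Y \<and> 2 * card (X \<union> Y) \<le> card V"
proof -
  have finP: "finite P" using four card.infinite by fastforce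
  have least: "\<exists>X \<in> Q. \<forall>Z \<in> Q. card X \<le> card Z" if "Q \<noteq> {}" for Q :: "'a set set"
    using that ex_has_least_nat[of "\<lambda>X. X \<in> Q" _ card] by blast
  have "P \<noteq> {}" using four by auto
  then obtain X where X: "X \<in> P" "\<And>Z. Z \<in> P \<Longrightarrow> card X \<le> card Z" using least by metis
  have c3: "card (P - {X}) \<ge> 3" using X four finP by simp
  then have "P - {X} \<noteq> {}" by (metis card.empty not_numeral_le_zero)
  then obtain Y where Y: "Y \<in> P - {X}" "\<And>Z. Z \<in> P - {X} \<Longrightarrow> card Y \<le> card Z" using least by metis
  have c2: "card (P - {X} - {Y}) \<ge> 2" using Y c3 finP by simp
  then have "P - {X} - {Y} \<noteq> {}" by (metis card.empty not_numeral_le_zero)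
  then obtain Z where Z: "Z \<in> P - {X} - {Y}" by blast
  have "card (P - {X} - {Y} - {Z}) \<ge> 1" using Z c2 finP by simp
  then have "P - {X} - {Y} - {Z} \<noteq> {}" by (metis card.empty not_one_le_zero)
  then obtain W where W: "W \<in> P - {X} - {Y} - {Z}" by blast
  have sub: "X \<subseteq> V" "Y \<subseteq> V" "Z \<subseteq> V" "W \<subseteq> V"
    using part X Y Z W by (auto simp: partition_on_def)
  have disj: "A \<inter> B = {}" if "A \<in> P" "B \<in> P" "A \<noteq> B" for A B
    using part that by (auto simp: partition_on_def disjoint_def)
  have d: "X \<inter> Y = {}" "Z \<inter> W = {}" "(X \<union> Y) \<inter> (Z \<union> W) = {}"
    using disj[OF X(1), of Y] disj[OF X(1), of Z] disj[OF X(1), of W] disj[of Y Z] disj[of Y W] disj[of Z W]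
      Y(1) Z W by (simp_all add: Int_Un_distrib Int_Un_distrib2 eq_commute)
  have fs: "finite X" "finite Y" "finite Z" "finite W" using sub fin finite_subset by blast+
  have "card (X \<union> Y) + card (Z \<union> W) \<le> card V"
    using card_Un_disjoint[of "X \<union> Y" "Z \<union> W"] card_mono[OF fin, of "X \<union> Y \<union> (Z \<union> W)"] d fs sub by simp
  moreover have "card (X \<union> Y) \<le> card (Z \<union> W)"
    using card_Un_disjoint[of X Y] card_Un_disjoint[of Z W] d fs X(2)[of Z] Y(2)[of W] Z W by simp
  ultimately show ?thesis using X Y by (intro bexI[of _ X] bexI[of _ Y]) auto
qed

lemma partition_merge:
  assumes part: "partition_on V P" and XY: "X \<in> P" "Y \<in> P" "X \<noteq> Y" and fin: "finite P"
  shows "partition_on V (insert (X \<union> Y) (P - {X, Y}))"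
    "card (insert (X \<union> Y) (P - {X, Y})) = card P - 1"
proof -
  have disj: "A \<inter> B = {}" if "A \<in> P" "B \<in> P" "A \<noteq> B" for A B
    using part that by (auto simp: partition_on_def disjoint_def)
  have ne: "A \<noteq> {}" if "A \<in> P" for A using part that by (auto simp: partition_on_def)
  show "partition_on V (insert (X \<union> Y) (P - {X, Y}))"
  proof (rule partition_onI)
    show "\<Union> (insert (X \<union> Y) (P - {X, Y})) = V"
      using part XY by (auto simp: partition_on_def)
    show "disjnt A B" if "A \<in> insert (X \<union> Y) (P - {X, Y})" "B \<in> insert (X \<union> Y) (P - {X, Y})" "A \<noteq> B" for A B
      using that XY disj unfolding disjnt_def by blast
    show "{} \<notin> insert (X \<union> Y) (P - {X, Y})"
      using ne XY by auto
  qed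
  have "X \<union> Y \<notin> P - {X, Y}"
  proof
    assume "X \<union> Y \<in> P - {X, Y}"
    then have "(X \<union> Y) \<inter> X = {}" using disj XY by blast
    then show False using ne XY by blast
  qed
  moreover have "card (P - {X, Y}) = card P - 2" "card P \<ge> 2"
    using XY fin card_mono[of P "{X, Y}"] by (auto simp: card_Diff_subset)
  ultimately show "card (insert (X \<union> Y) (P - {X, Y})) = card P - 1"
    using fin by simp
qed

lemma tripartite_partition:
  fixes red :: "'a \<Rightarrow> 'a \<Rightarrow> bool"
  assumes fin: "finite V" and part: "partition_on V P" and three: "card P = 3" and fair: "fair V P"
    and sym: "\<And>u v. red u v = red v u"
  shows "\<exists>r b. mono_path (cmp_adj P) red True r \<and> mono_path (cmp_adj P) red False b
           \<and> set r \<inter> set b = {} \<and> set r \<union> set b = V"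
proof -
  define c where "c = (\<lambda>x. {X \<in> P. x \<in> X})"
  interpret two_colouring c red by unfold_locales (rule sym)
  have cX: "c x = {X}" if "X \<in> P" "x \<in> X" for x X
    using part that by (auto simp: c_def partition_on_def disjoint_def)
  have cover: "\<exists>X \<in> P. x \<in> X" if "x \<in> V" for x
    using part that by (auto simp: partition_on_def)
  have sub: "X \<subseteq> V" "X \<noteq> {}" if "X \<in> P" for X
    using part that by (auto simp: partition_on_def)
  have "c ` V = (\<lambda>X. {X}) ` P"
  proof
    show "c ` V \<subseteq> (\<lambda>X. {X}) ` P"
    proof (rule image_subsetI)
      fix x assume "x \<in> V"
      then obtain X where "X \<in> P" "x \<in> X" using cover by blast
      then show "c x \<in> (\<lambda>X. {X}) ` P" using cX[of X x] by simp
    qed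
    show "(\<lambda>X. {X}) ` P \<subseteq> c ` V"
    proof
      fix Z assume "Z \<in> (\<lambda>X. {X}) ` P"
      then obtain X where X: "X \<in> P" "Z = {X}" by auto
      then obtain x where "x \<in> X" using sub by blast
      then show "Z \<in> c ` V" using X cX sub by blast
    qed
  qed
  then have card3: "card (c ` V) = 3" using three by (simp add: card_image)
  have "2 * card (class_of V x) \<le> card V" if "x \<in> V" for x
  proof -
    obtain X where X: "X \<in> P" "x \<in> X" using cover[OF \<open>x \<in> V\<close>] by blast
    have "class_of V x = X"
    proof
      show "class_of V x \<subseteq> X"
      proof
        fix z assume "z \<in> class_of V x"
        then have "X \<in> c z" using cX[OF X] by (simp add: class_of_def)
        then show "z \<in> X" by (simp add: c_def)
      qed
      show "X \<subseteq> class_of V x"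
        using cX[OF X] cX[OF X(1)] sub(1)[OF X(1)] by (auto simp: class_of_def)
    qed
    then show ?thesis using fair X by (auto simp: fair_def)
  qed
  then have "hamiltonian V" using fair_tripartite_hamiltonian[OF fin card3] by blast
  then obtain k w R B where "spider k V w R B" by (auto simp: hamiltonian_def ham_def)
  \<comment> \<open>The centre is kept on one arm only, which turns the spider into two disjoint
    paths.\<close>
  from spider_cover[OF this] have cov: "cover k V (w # R) B" .
  have mp: "mono_path (cmp_adj P) red j p" if "path j p" "distinct p" "set p \<subseteq> V" for j p
  proof -
    have "cmp_adj P (p ! i) (p ! Suc i) \<and> red (p ! i) (p ! Suc i) = j" if "Suc i < length p" for i
    proof -
      have l: "link j (p ! i) (p ! Suc i)"
        using \<open>path j p\<close> that by (simp add: successively_conv_nth)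
      have "p ! i \<in> V" "p ! Suc i \<in> V" using \<open>set p \<subseteq> V\<close> that by auto
      then have "cmp_adj P (p ! i) (p ! Suc i)"
        using l cover cX unfolding cmp_adj_def link_def by metis
      then show ?thesis using l by (auto simp: link_def)
    qed
    then show ?thesis using that by (auto simp: mono_path_def)
  qed
  have "cover True V (w # R) B \<or> cover True V B (w # R)"
    using cov cover_swap[OF cov] by (cases k) auto
  then obtain r b where "cover True V r b" by blast
  then show ?thesis
    using mp[of True r] mp[of False b] by (intro exI[of _ r] exI[of _ b]) (auto simp: cover_def)
qed

theorem theorem1p4:
  fixes V :: "'a set" and P :: "'a set set" and k :: nat
    and red :: "'a \<Rightarrow> 'a \<Rightarrow> bool"
  assumes "finite V"
    and "partition_on V P"
    and "card P = k" and "k \<ge> 3"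
    and "fair V P"
    and "\<And>u v. red u v = red v u"
  shows "\<exists>r b. mono_path (cmp_adj P) red True r \<and> mono_path (cmp_adj P) red False b
           \<and> set r \<inter> set b = {} \<and> set r \<union> set b = V"
  using assms(2-5)
proof (induction k arbitrary: P rule: less_induct)
  case (less k)
  show ?case
  proof (cases "k = 3")
    case True
    then show ?thesis using tripartite_partition[OF assms(1)] less.prems assms(6) by blast
  next
    case False
    then have "card P \<ge> 4" using less.prems by simp
    then obtain X Y where XY: "X \<in> P" "Y \<in> P" "X \<noteq> Y" "2 * card (X \<union> Y) \<le> card V"
      using small_pair[OF assms(1) less.prems(1)] by blast
    let ?Q = "insert (X \<union> Y) (P - {X, Y})"
    have "finite P" using \<open>card P \<ge> 4\<close> card.infinite by fastforce
    note Q = partition_merge[OF less.prems(1) XY(1-3) this]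
    have "fair V ?Q" using less.prems(4) XY(4) by (auto simp: fair_def)
    moreover have "k - 1 < k" "k - 1 \<ge> 3" "card ?Q = k - 1" using less.prems False Q(2) by auto
    ultimately obtain r b where "mono_path (cmp_adj ?Q) red True r" "mono_path (cmp_adj ?Q) red False b"
      "set r \<inter> set b = {}" "set r \<union> set b = V"
      using less.IH[of "k - 1" ?Q] Q(1) by blast
    \<comment> \<open>The colouring is the same for both partitions, so paths of the merged graph
      carry over.\<close>
    moreover have "mono_path (cmp_adj P) red j p" if "mono_path (cmp_adj ?Q) red j p" for j p
      using mono_path_mono[OF that] cmp_adj_merge[OF XY(1,2)] by blast
    ultimately show ?thesis by blast
  qed
qed

end
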